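(* Let $k,m$ be positive integers. Let $G_1=N(\mu_1,I+\Sigma_1),\dots,G_k=N(\mu_k,I+\Sigma_k)$ be Gaussians on $\mathbb{R}^d$ in $(\alpha,\beta)$-regular form and let $P_1,\dots,P_k$ be real polynomials in $d$ variables of degree at most $m$. Let \[f(X,y)=\sum_{j=1}^k P_j(Xy)\,e^{\mu_j(X)y+\frac12\Sigma_j(X)y^2}=\sum_{r\ge0}\frac{f_r(X)}{r!}y^r\] be the generating function of the polynomial combination with primary terms $f_0,f_1,\dots$. There exists a constant $C$ depending only on $k,m$ such that if $\|v(f_r(X))\|\le\epsilon$ for all $0\le r\le C$, then \[\|\chi(f(X,i))\|_1\le(2+\alpha+\beta)^C\epsilon.\]
   Context: For $\mu\in\mathbb{R}^d$ and a $d\times d$ matrix $\Sigma$, $\mu(X)=\mu^TX$ and $\Sigma(X)=X^T\Sigma X$ for formal variables $X=(X_1,\dots,X_d)$; $Xy$ denotes $(X_1y,\dots,X_dy)$. $f(X,y)$ is regarded as a formal power series in $y$ whose coefficients $f_r(X)/r!$ are polynomials in $X$ (each $f_r$ is homogeneous of degree $r$); the $f_r$ are called primary terms. $f(X,i)$ is the function $\mathbb{R}^d\to\mathbb{C}$, $X\mapsto\sum_j P_j(iX)e^{i\mu_j(X)-\frac12\Sigma_j(X)}$ ($i=\sqrt{-1}$). For $g:\mathbb{R}^d\to\mathbb{C}$, $\chi g(t)=\frac{1}{(2\pi)^d}\int_{\mathbb{R}^d}g(X)e^{-\frac12\|X\|^2-it\cdot X}\,dX$ (inverse of the adjusted characteristic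 function $\widetilde{f}(X)=\int f(z)e^{iz\cdot X+\frac12\|X\|^2}dz$), and $\|\cdot\|_1$ is the $L^1$ norm on $\mathbb{R}^d$. $(\alpha,\beta)$-regular form: for all $j$, $\|\mu_j\|\le\alpha$, $\|\Sigma_j\|_2\le\alpha$ (Frobenius norm), and $\beta^{-1}I\preceq I+\Sigma_j\preceq\beta I$. For a homogeneous real polynomial $p$ of degree $r$ in $X$, $v(p)$ is the flattening of the unique symmetric tensor $T(p)\in(\mathbb{R}^d)^{\otimes r}$ with $\langle T(p),X^{\otimes r}\rangle=p(X)$, and $\|v(p)\|$ its Euclidean norm. *)

theory Defs
  imports "HOL-Analysis.Analysis" "HOL-Combinatorics.Permutations"
begin

text \<open>Vectors in R^d are functions nat => real, only coordinates i < d matter;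
  matrices are nat => nat => real. Lebesgue measure on R^d is the product measure.\<close>

definition Rd :: "nat \<Rightarrow> (nat \<Rightarrow> real) measure" where
  "Rd d = PiM {..<d} (\<lambda>_. lborel)"

definition dotp :: "nat \<Rightarrow> (nat \<Rightarrow> real) \<Rightarrow> (nat \<Rightarrow> real) \<Rightarrow> real" where
  "dotp d x y = (\<Sum>i<d. x i * y i)"

definition sqnorm :: "nat \<Rightarrow> (nat \<Rightarrow> real) \<Rightarrow> real" where
  "sqnorm d x = (\<Sum>i<d. (x i)\<^sup>2)"

definition quadf :: "nat \<Rightarrow> (nat \<Rightarrow> nat \<Rightarrow> real) \<Rightarrow> (nat \<Rightarrow> real) \<Rightarrow> real" where
  "quadf d S X = (\<Sum>i<d. \<Sum>l<d. X i * S i l * X l)"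

definition multi_idx :: "nat \<Rightarrow> nat \<Rightarrow> (nat \<Rightarrow> nat) set" where
  "multi_idx d m = {a. (\<forall>i. d \<le> i \<longrightarrow> a i = 0) \<and> (\<Sum>i<d. a i) \<le> m}"

definition mpoly_eval :: "nat \<Rightarrow> nat \<Rightarrow> ((nat \<Rightarrow> nat) \<Rightarrow> real) \<Rightarrow> (nat \<Rightarrow> 'a::real_field) \<Rightarrow> 'a" where
  "mpoly_eval d m c X = (\<Sum>a\<in>multi_idx d m. of_real (c a) * (\<Prod>i<d. X i ^ a i))"

definition gen_fun :: "nat \<Rightarrow> nat \<Rightarrow> nat \<Rightarrow> (nat \<Rightarrow> (nat \<Rightarrow> nat) \<Rightarrow> real)
   \<Rightarrow> (nat \<Rightarrow> nat \<Rightarrow> real) \<Rightarrow> (nat \<Rightarrow> nat \<Rightarrow> nat \<Rightarrow> real) \<Rightarrow> (nat \<Rightarrow> real) \<Rightarrow> real \<Rightarrow> real" where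
  "gen_fun d m k c mu Sig X y =
     (\<Sum>j<k. mpoly_eval d m (c j) (\<lambda>i. X i * y) *
              exp (dotp d (mu j) X * y + 1/2 * quadf d (Sig j) X * y\<^sup>2))"

text \<open>Primary term f_r: r! times the coefficient of y^r, i.e. the r-th derivative in y at 0.\<close>
definition primary_term :: "nat \<Rightarrow> nat \<Rightarrow> nat \<Rightarrow> (nat \<Rightarrow> (nat \<Rightarrow> nat) \<Rightarrow> real)
   \<Rightarrow> (nat \<Rightarrow> nat \<Rightarrow> real) \<Rightarrow> (nat \<Rightarrow> nat \<Rightarrow> nat \<Rightarrow> real) \<Rightarrow> nat \<Rightarrow> (nat \<Rightarrow> real) \<Rightarrow> real" where
  "primary_term d m k c mu Sig r X = (deriv ^^ r) (gen_fun d m k c mu Sig X) 0"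

definition gen_fun_i :: "nat \<Rightarrow> nat \<Rightarrow> nat \<Rightarrow> (nat \<Rightarrow> (nat \<Rightarrow> nat) \<Rightarrow> real)
   \<Rightarrow> (nat \<Rightarrow> nat \<Rightarrow> real) \<Rightarrow> (nat \<Rightarrow> nat \<Rightarrow> nat \<Rightarrow> real) \<Rightarrow> (nat \<Rightarrow> real) \<Rightarrow> complex" where
  "gen_fun_i d m k c mu Sig X =
     (\<Sum>j<k. mpoly_eval d m (c j) (\<lambda>i. \<i> * complex_of_real (X i)) *
              exp (\<i> * complex_of_real (dotp d (mu j) X) - complex_of_real (1/2 * quadf d (Sig j) X)))"

definition chi :: "nat \<Rightarrow> ((nat \<Rightarrow> real) \<Rightarrow> complex) \<Rightarrow> (nat \<Rightarrow> real) \<Rightarrow> complex" where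
  "chi d g t = complex_of_real (1 / (2 * pi) ^ d) *
     (\<integral>X. g X * exp (complex_of_real (- (1/2) * sqnorm d X) - \<i> * complex_of_real (dotp d t X)) \<partial>Rd d)"

definition L1norm :: "nat \<Rightarrow> ((nat \<Rightarrow> real) \<Rightarrow> complex) \<Rightarrow> ennreal" where
  "L1norm d h = (\<integral>\<^sup>+ t. ennreal (cmod (h t)) \<partial>Rd d)"

definition tidx :: "nat \<Rightarrow> nat \<Rightarrow> (nat \<Rightarrow> nat) set" where
  "tidx d r = {..<r} \<rightarrow>\<^sub>E {..<d}"

definition sym_tensor :: "nat \<Rightarrow> nat \<Rightarrow> ((nat \<Rightarrow> real) \<Rightarrow> real) \<Rightarrow> (nat \<Rightarrow> nat) \<Rightarrow> real" where
  "sym_tensor d r p = (THE T.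
      (\<forall>i. i \<notin> tidx d r \<longrightarrow> T i = 0) \<and>
      (\<forall>i\<in>tidx d r. \<forall>\<sigma>. \<sigma> permutes {..<r} \<longrightarrow> T (i \<circ> \<sigma>) = T i) \<and>
      (\<forall>X. (\<Sum>i\<in>tidx d r. T i * (\<Prod>l<r. X (i l))) = p X))"

text \<open>Euclidean norm of the flattening v(p) of T(p).\<close>
definition vnorm :: "nat \<Rightarrow> nat \<Rightarrow> ((nat \<Rightarrow> real) \<Rightarrow> real) \<Rightarrow> real" where
  "vnorm d r p = sqrt (\<Sum>i\<in>tidx d r. (sym_tensor d r p i)\<^sup>2)"

definition regular_form :: "nat \<Rightarrow> nat \<Rightarrow> real \<Rightarrow> real \<Rightarrow> (nat \<Rightarrow> nat \<Rightarrow> real)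
    \<Rightarrow> (nat \<Rightarrow> nat \<Rightarrow> nat \<Rightarrow> real) \<Rightarrow> bool" where
  "regular_form d k \<alpha> \<beta> mu Sig \<longleftrightarrow> 0 < \<beta> \<and> (\<forall>j<k.
      sqrt (sqnorm d (mu j)) \<le> \<alpha> \<and>
      sqrt (\<Sum>i<d. \<Sum>l<d. (Sig j i l)\<^sup>2) \<le> \<alpha> \<and>
      (\<forall>i<d. \<forall>l<d. Sig j i l = Sig j l i) \<and>
      (\<forall>x. (1/\<beta>) * sqnorm d x \<le> sqnorm d x + quadf d (Sig j) x \<and>
           sqnorm d x + quadf d (Sig j) x \<le> \<beta> * sqnorm d x))"

end

theory Submission
  imports Defs "HOL-Probability.Probability"
begin

text \<open>
  On the line through X, f(X,y) is a combination of polynomials times exponentials, so it is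
  annihilated by a product of first order operators \<open>d/dy - (\<mu>\<^sub>j(X) + \<Sigma>\<^sub>j(X) y)\<close> whose length
  depends only on k and m. Solving the factors one after another by variation of constants along
  the segment from 0 to \<open>\<i>\<close> writes f(X,\<open>\<i>\<close>) as a sum of iterated integrals whose integrands are a form
  in X, built from the first few primary terms, times \<open>exp (\<i>\<nu>(X) - \<Sigma>\<^sub>j w\<^sub>j \<Sigma>\<^sub>j(X) / 2)\<close>. The weights w are
  nonnegative and sum to 1, because the increments of \<open>\<tau>\<^sup>2\<close> along the segment telescope, so after
  multiplication by the standard Gaussian the covariance stays at least \<open>I/\<beta>\<close>.

  For a form p times such a Gaussian the L1 norm of the Fourier transform is bounded free of the dimension:
  the part of the covariance beyond \<open>I/\<beta>\<close> acts as convolution with a probability measure, and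
  for the isotropic part the transform is a Hermite expansion whose L2 norm is controlled by the
  norm of any tensor representing p. Since tensor norms are multiplicative, products with \<open>\<mu>\<^sub>j\<close> and
  \<open>\<Sigma>\<^sub>j\<close> cost only powers of \<open>\<alpha>\<close>.
\<close>

subsection \<open>One-dimensional Hermite polynomials and Gaussian integrals\<close>

text \<open>The hypothesis bounds finitely many primary terms, whereas the Taylor series of f(X,y)
  at y = \<i> calls for all of them, and nothing bounds the coefficients of the P_j. A linear
  differential equation resolves this: its order N is fixed by k and m, so the first N derivatives
  at 0 determine the function. Solving one factor replaces the derivatives F^(n) by F^(n+1) - mu_l
  F^(n) - n Sigma_l F^(n-1), so a bound on the first N survives on the first N - 1 at the price of a
  factor 1 + \<alpha> + N \<alpha>, for forms of one degree more. A single Sigma_l may be indefinite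
  and only I + Sigma_l is bounded below, which is why the weights of the Sigma_l are kept at total 1
  beside the one copy of I. Clearing an index takes one operator per coefficient of its polynomial,
  and the operators for earlier indices have already lengthened that polynomial; hence the recursion
  N' = 2 N + m + 1 from one index to the next, and N = (2^k - 1)(m + 1).\<close>

lemma lborel_integral_of_derivative_zero:
  fixes F f :: "real \<Rightarrow> 'a::euclidean_space"
  assumes F: "\<And>x. (F has_vector_derivative f x) (at x)"
    and cont: "\<And>x. isCont f x"
    and int: "integrable lborel f"
    and lim: "(F \<longlongrightarrow> 0) at_top" "(F \<longlongrightarrow> 0) at_bot"
  shows "(\<integral>x. f x \<partial>lborel) = 0"
proof -
  have "(LBINT x=-\<infinity>..\<infinity>. f x) = 0 - 0"
  proof (rule interval_integral_FTC_integrable)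
    show "set_integrable lborel (einterval (-\<infinity>) \<infinity>) f"
      using int by (simp add: set_integrable_def)
    show "((F \<circ> real_of_ereal) \<longlongrightarrow> 0) (at_right (-\<infinity>))"
      using lim(2) by (simp add: at_right_MInf tendsto_compose_filtermap[symmetric] comp_def filterlim_filtermap)
    show "((F \<circ> real_of_ereal) \<longlongrightarrow> 0) (at_left \<infinity>)"
      using lim(1) by (simp add: at_left_PInf comp_def filterlim_filtermap)
  qed (use assms in auto)
  then show ?thesis
    by (simp add: interval_lebesgue_integral_def set_lebesgue_integral_def)
qed

lemma integrable_power_times_gaussian:
  fixes b :: real
  assumes "0 < b"
  shows "integrable lborel (\<lambda>x. x ^ a * exp (- (b/2) * x\<^sup>2))"
proof -
  have "integrable lborel (\<lambda>x. sqrt (2*pi/b) * (normal_density 0 (1 / sqrt b) x * (x - 0) ^ a))"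
    by (intro integrable_mult_right integrable_normal_moment) (use assms in simp)
  also have "(\<lambda>x. sqrt (2*pi/b) * (normal_density 0 (1 / sqrt b) x * (x - 0) ^ a)) =
      (\<lambda>x. x ^ a * exp (- (b/2) * x\<^sup>2))"
    using assms by (auto simp: normal_density_def power_divide real_sqrt_divide real_sqrt_mult field_simps)
  finally show ?thesis .
qed

lemma power_times_gaussian_tendsto_0:
  fixes b :: real
  assumes "0 < b"
  shows "((\<lambda>x. x ^ a * exp (- (b/2) * x\<^sup>2)) \<longlongrightarrow> 0) at_top"
    and "((\<lambda>x. x ^ a * exp (- (b/2) * x\<^sup>2)) \<longlongrightarrow> 0) at_bot"
proof -
  show *: "((\<lambda>x. x ^ a * exp (- (b/2) * x\<^sup>2)) \<longlongrightarrow> 0) at_top"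
  proof (rule tendsto_sandwich[of "\<lambda>_. 0"])
    \<comment> \<open>For x \<ge> 1 the power x^a is at most (x^2)^a, so the known limit of y^a /
      exp y along y = b x^2 / 2 dominates.\<close>
    let ?y = "\<lambda>x::real. (b/2) * x\<^sup>2"
    have "filterlim ?y at_top at_top"
      using assms by (intro filterlim_tendsto_pos_mult_at_top[OF tendsto_const] filterlim_pow_at_top filterlim_ident) auto
    from filterlim_compose[OF tendsto_power_div_exp_0[of a] this]
    have "((\<lambda>x. (2/b)^a * (?y x ^ a / exp (?y x))) \<longlongrightarrow> (2/b)^a * 0) at_top"
      by (intro tendsto_intros)
    then show "((\<lambda>x. (2/b)^a * (?y x ^ a / exp (?y x))) \<longlongrightarrow> 0) at_top" by simp
    show "eventually (\<lambda>x. x ^ a * exp (- (b/2) * x\<^sup>2) \<le> (2/b)^a * (?y x ^ a / exp (?y x))) at_top"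
      using eventually_ge_at_top[of 1]
    proof eventually_elim
      case (elim x)
      have "x ^ a \<le> (x\<^sup>2) ^ a" using elim by (intro power_mono) (auto simp: power2_eq_square)
      also have "(x\<^sup>2) ^ a = (2/b)^a * ?y x ^ a" using assms by (simp flip: power_mult_distrib)
      finally show ?case by (simp add: exp_minus field_simps)
    qed
    show "eventually (\<lambda>x. 0 \<le> x ^ a * exp (- (b/2) * x\<^sup>2)) at_top"
      using eventually_ge_at_top[of 0] by eventually_elim simp
  qed simp
  have "((\<lambda>x. (-1)^a * (x ^ a * exp (- (b/2) * x\<^sup>2))) \<longlongrightarrow> (-1)^a * 0) at_top"
    by (intro tendsto_intros *)
  moreover have "(\<lambda>x. (-1)^a * (x ^ a * exp (- (b/2) * x\<^sup>2))) = (\<lambda>x. (- x) ^ a * exp (- (b/2) * (- x)\<^sup>2))"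
    by (simp add: fun_eq_iff flip: power_mult_distrib)
  ultimately show "((\<lambda>x. x ^ a * exp (- (b/2) * x\<^sup>2)) \<longlongrightarrow> 0) at_bot"
    by (subst filterlim_at_bot_mirror) simp
qed

text \<open>Normalised to be orthogonal for the centred Gaussian of variance b.\<close>
fun hermite :: "real \<Rightarrow> nat \<Rightarrow> real poly" where
  "hermite b 0 = 1"
| "hermite b (Suc n) = [:0, 1/b:] * hermite b n - pderiv (hermite b n)"

text \<open>The recursion of \<open>hermite\<close> raises the index and differentiation lowers it;
  this pair of relations yields both the orthogonality and the three-term recurrence.\<close>

lemma pderiv_hermite: "pderiv (hermite b (Suc n)) = smult (of_nat (Suc n) / b) (hermite b n)"
proof (induction n)
  case (Suc n)
  have "pderiv (hermite b (Suc (Suc n))) =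
      smult (1/b) (hermite b (Suc n)) + [:0, 1/b:] * pderiv (hermite b (Suc n)) - pderiv (pderiv (hermite b (Suc n)))"
    by (simp only: hermite.simps(2)[of b "Suc n"] pderiv_diff pderiv_mult) (simp add: pderiv_pCons del: hermite.simps)
  also have "\<dots> = smult (1/b) (hermite b (Suc n)) + smult (of_nat (Suc n) / b) (hermite b (Suc n))"
    unfolding Suc by (simp add: pderiv_smult smult_diff_right)
  also have "\<dots> = smult (of_nat (Suc (Suc n)) / b) (hermite b (Suc n))"
    by (simp only: smult_add_left[symmetric]) (simp add: field_simps add_divide_distrib)
  finally show ?case .
qed (simp add: pderiv_pCons)

lemma integrable_normal_poly:
  assumes "0 < b"
  shows "integrable lborel (\<lambda>x. normal_density 0 (sqrt b) x * poly p x)"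
proof -
  have "integrable lborel (\<lambda>x. \<Sum>i\<le>degree p. coeff p i * (normal_density 0 (sqrt b) x * (x - 0) ^ i))"
    by (intro Bochner_Integration.integrable_sum integrable_mult_right integrable_normal_moment) (use assms in simp)
  then show ?thesis
    by (simp add: poly_altdef sum_distrib_left mult_ac)
qed

text \<open>The integrand is the derivative of minus the density times p. Hence the operator that
  raises Hermite indices is the adjoint of differentiation under the Gaussian of variance b.\<close>

lemma normal_poly_by_parts:
  assumes b: "0 < b"
  shows "(\<integral>x. normal_density 0 (sqrt b) x * poly ([:0, 1/b:] * p - pderiv p) x \<partial>lborel) = 0"
proof -
  have G: "(normal_density 0 (sqrt b) has_real_derivative - (x / b) * normal_density 0 (sqrt b) x) (at x)" for x
    unfolding normal_density_def using b by (auto intro!: derivative_eq_intros simp: field_simps)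
  have tend: "((\<lambda>x. - (normal_density 0 (sqrt b) x * poly p x)) \<longlongrightarrow> 0) F" if "F = at_top \<or> F = at_bot" for F
  proof -
    have "((\<lambda>x. - (\<Sum>i\<le>degree p. (coeff p i / sqrt (2*pi*b)) * (x ^ i * exp (- (1/b/2) * x\<^sup>2))))
        \<longlongrightarrow> - (\<Sum>i\<le>degree p. (coeff p i / sqrt (2*pi*b)) * 0)) F"
      using power_times_gaussian_tendsto_0[of "1/b"] b that by (intro tendsto_intros) auto
    moreover have "(\<lambda>x. - (\<Sum>i\<le>degree p. (coeff p i / sqrt (2*pi*b)) * (x ^ i * exp (- (1/b/2) * x\<^sup>2))))
       = (\<lambda>x. - (normal_density 0 (sqrt b) x * poly p x))"
      using b by (auto simp: normal_density_def poly_altdef sum_distrib_left sum_distrib_right sum_divide_distrib mult_ac)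
    ultimately show ?thesis by simp
  qed
  show ?thesis
  proof (rule lborel_integral_of_derivative_zero[where F = "\<lambda>x. - (normal_density 0 (sqrt b) x * poly p x)"])
    fix x
    have "((\<lambda>x. - (normal_density 0 (sqrt b) x * poly p x)) has_real_derivative
        normal_density 0 (sqrt b) x * poly ([:0, 1/b:] * p - pderiv p) x) (at x)"
      by (auto intro!: derivative_eq_intros G simp: field_simps)
    then show "((\<lambda>x. - (normal_density 0 (sqrt b) x * poly p x)) has_vector_derivative
        normal_density 0 (sqrt b) x * poly ([:0, 1/b:] * p - pderiv p) x) (at x)"
      by (simp add: has_real_derivative_iff_has_vector_derivative)
    show "isCont (\<lambda>x. normal_density 0 (sqrt b) x * poly ([:0, 1/b:] * p - pderiv p) x) x"
      by (intro continuous_intros DERIV_isCont[OF G])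
    show "integrable lborel (\<lambda>x. normal_density 0 (sqrt b) x * poly ([:0, 1/b:] * p - pderiv p) x)"
      by (rule integrable_normal_poly[OF b])
  qed (use tend in auto)
qed

text \<open>By adjointness a raising operator in the first factor becomes a derivative on the
  second, which lowers its index and contributes n / b; these factors accumulate to n! / b^n. If the
  indices differ, one of them reaches 0 first and the integral vanishes.\<close>

lemma hermite_orthogonal:
  assumes b: "0 < b"
  shows "(\<integral>x. normal_density 0 (sqrt b) x * poly (hermite b m * hermite b n) x \<partial>lborel) =
    (if m = n then fact n / b ^ n else 0)"
proof (induction m arbitrary: n)
  have step: "(\<integral>x. normal_density 0 (sqrt b) x * poly (hermite b (Suc m) * q) x \<partial>lborel) =
      (\<integral>x. normal_density 0 (sqrt b) x * poly (hermite b m * pderiv q) x \<partial>lborel)" for m q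
  proof -
    have "hermite b (Suc m) * q = ([:0, 1/b:] * (hermite b m * q) - pderiv (hermite b m * q)) + hermite b m * pderiv q"
      by (simp add: pderiv_mult algebra_simps)
    then have "(\<lambda>x. normal_density 0 (sqrt b) x * poly (hermite b (Suc m) * q) x) =
      (\<lambda>x. normal_density 0 (sqrt b) x * poly ([:0, 1/b:] * (hermite b m * q) - pderiv (hermite b m * q)) x +
         normal_density 0 (sqrt b) x * poly (hermite b m * pderiv q) x)"
      by (simp only: poly_add distrib_left)
    then show ?thesis
      using normal_poly_by_parts[OF b, of "hermite b m * q"]
      by (simp add: integrable_normal_poly[OF b] del: poly_mult poly_diff)
  qed
  have base: "(\<integral>x. normal_density 0 (sqrt b) x * poly (hermite b 0 * hermite b n) x \<partial>lborel) = (if n = 0 then 1 else 0)" for n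
  proof (cases n)
    case 0
    then show ?thesis using b by (simp add: integral_normal_density)
  next
    case (Suc k)
    then show ?thesis using normal_poly_by_parts[OF b, of "hermite b k"] by simp
  qed
  { case 0 show ?case using base[of n] by (cases n) simp_all }
  case (Suc m)
  show ?case
  proof (cases n)
    case 0
    then show ?thesis using base[of "Suc m"] by (simp add: mult.commute)
  next
    case (Suc k)
    have "(\<integral>x. normal_density 0 (sqrt b) x * poly (hermite b (Suc m) * hermite b n) x \<partial>lborel)
       = (\<integral>x. (of_nat (Suc k) / b) * (normal_density 0 (sqrt b) x * poly (hermite b m * hermite b k) x) \<partial>lborel)"
      unfolding step Suc pderiv_hermite by (intro Bochner_Integration.integral_cong) simp_all
    also have "\<dots> = (of_nat (Suc k) / b) * (if m = k then fact k / b ^ k else 0)"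
      using Suc.IH[of k] by (simp del: poly_mult)
    finally have "(\<integral>x. normal_density 0 (sqrt b) x * poly (hermite b (Suc m) * hermite b n) x \<partial>lborel)
       = (of_nat (Suc k) / b) * (if m = k then fact k / b ^ k else 0)" .
    moreover have "\<dots> = (if Suc m = n then fact n / b ^ n else 0)"
      using Suc by (simp add: field_simps add_divide_distrib)
    ultimately show ?thesis by (rule trans)
  qed
qed

text \<open>Brought into the shape of the recursion for Fourier moments in
  \<open>fourier_power_gaussian\<close>.\<close>

lemma hermite_three_term:
  "hermite b (Suc (Suc n)) = smult (1/b) ([:0, 1:] * hermite b (Suc n) - smult (of_nat (Suc n)) (hermite b n))"
  using pderiv_hermite[of b n] by (simp only: hermite.simps(2)[of b "Suc n"]) (simp add: algebra_simps smult_diff_right add_divide_distrib del: hermite.simps)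

lemma integrable_complex_power_gaussian:
  assumes b: "0 < b"
  shows "integrable lborel (\<lambda>x. complex_of_real x ^ a * exp (complex_of_real (- (b/2) * x\<^sup>2) - \<i> * complex_of_real (t * x)))"
proof (rule Bochner_Integration.integrable_bound)
  show "integrable lborel (\<lambda>x. x ^ a * exp (- (b/2) * x\<^sup>2))"
    using integrable_power_times_gaussian[OF b] .
qed (auto simp: norm_mult norm_power abs_mult power_abs)

text \<open>Rescaling by sqrt b leaves the characteristic function of the standard normal law at - t
  / sqrt b. With the result written as 2 pi times a density, the factor cancels the normalisation of
  \<open>ft\<close> coordinate by coordinate.\<close>

lemma fourier_gaussian:
  assumes b: "0 < b"
  shows "(\<integral>x. exp (complex_of_real (- (b/2) * x\<^sup>2) - \<i> * complex_of_real (t * x)) \<partial>lborel) =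
    complex_of_real (2 * pi * normal_density 0 (sqrt b) t)"
proof -
  define s where "s = sqrt b"
  have s: "s > 0" "s\<^sup>2 = b" using b by (auto simp: s_def)
  let ?f = "\<lambda>x. exp (complex_of_real (- (b/2) * x\<^sup>2) - \<i> * complex_of_real (t * x))"
  have 1: "(\<integral>x. ?f x \<partial>lborel) = (1/s) *\<^sub>R (\<integral>x. ?f (x/s) \<partial>lborel)"
    using s lborel_integral_real_affine[of "1/s" ?f 0] by simp
  have "?f (x/s) = complex_of_real (sqrt (2*pi)) * (std_normal_density x *\<^sub>R iexp ((-t/s) * x))" for x
  proof -
    have "- (b/2) * (x/s)\<^sup>2 = - x\<^sup>2 / 2" "t * (x/s) = - ((-t/s) * x)"
      using s b by (auto simp: power_divide)
    moreover have "exp (complex_of_real u - \<i> * complex_of_real (- w)) = complex_of_real (exp u) * iexp w" for u w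
      by (simp only: exp_of_real[symmetric] exp_add[symmetric]) simp
    ultimately show ?thesis
      by (simp only:) (simp add: std_normal_density_def scaleR_conv_of_real)
  qed
  then have "(\<integral>x. ?f (x/s) \<partial>lborel) = complex_of_real (sqrt (2*pi)) * (\<integral>x. std_normal_density x *\<^sub>R iexp ((-t/s) * x) \<partial>lborel)"
    by (simp only: integral_mult_right_zero)
  also have "(\<integral>x. std_normal_density x *\<^sub>R iexp ((-t/s) * x) \<partial>lborel) = char std_normal_distribution (-t/s)"
    unfolding char_def by (subst integral_density) (auto simp: mult_ac)
  also have "\<dots> = complex_of_real (exp (- (t\<^sup>2 / (2*b))))"
    using s by (simp add: char_std_normal_distribution power_divide field_simps)
  finally show ?thesis
    unfolding 1 using s b
    by (simp add: normal_density_def scaleR_conv_of_real real_sqrt_mult s_def[symmetric] field_simps flip: of_real_mult of_real_divide)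
qed

text \<open>Integrating the derivative of x^a E over the line gives a recursion for the moments, and
  (-\<i>)^a times the Hermite polynomials satisfies the same one. It reaches back two indices, so
  the induction carries two consecutive moments.\<close>

lemma fourier_power_gaussian:
  assumes b: "0 < b"
  shows "(\<integral>x. complex_of_real x ^ a * exp (complex_of_real (- (b/2) * x\<^sup>2) - \<i> * complex_of_real (t * x)) \<partial>lborel) =
    (-\<i>) ^ a * complex_of_real (2 * pi * (poly (hermite b a) t * normal_density 0 (sqrt b) t))"
proof -
  define E where "E x = exp (complex_of_real (- (b/2) * x\<^sup>2) - \<i> * complex_of_real (t * x))" for x
  define M where "M a = (\<integral>x. complex_of_real x ^ a * E x \<partial>lborel)" for a
  have int: "integrable lborel (\<lambda>x. complex_of_real x ^ a * E x)" for a
    unfolding E_def by (rule integrable_complex_power_gaussian[OF b])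
  have contE: "isCont E x" for x unfolding E_def by (intro continuous_intros)
  have tend: "((\<lambda>x. complex_of_real x ^ a * E x) \<longlongrightarrow> 0) F" if "F = at_top \<or> F = at_bot" for F a
  proof (rule tendsto_norm_zero_cancel)
    have "((\<lambda>x. \<bar>x ^ a * exp (- (b/2) * x\<^sup>2)\<bar>) \<longlongrightarrow> 0) F"
      using power_times_gaussian_tendsto_0[OF b] that by (intro tendsto_rabs_zero) auto
    then show "((\<lambda>x. norm (complex_of_real x ^ a * E x)) \<longlongrightarrow> 0) F"
      by (simp add: E_def norm_mult norm_power abs_mult power_abs)
  qed
  have dE: "(E has_vector_derivative (- of_real b * of_real x - \<i> * of_real t) * E x) (at x)" for x
  proof -
    have "((\<lambda>z. exp (- (of_real b/2) * z\<^sup>2 - \<i> * (of_real t * z))) has_field_derivative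
        (- of_real b * of_real x - \<i> * of_real t) * exp (- (of_real b/2) * (of_real x)\<^sup>2 - \<i> * (of_real t * of_real x))) (at (complex_of_real x))"
      by (auto intro!: derivative_eq_intros simp: algebra_simps)
    from has_vector_derivative_real_field[OF this] show ?thesis
      by (simp add: E_def[abs_def])
  qed
  \<comment> \<open>For a = 0 the truncated index a - 1 is harmless, as its coefficient is
    0.\<close>
  have rec: "M (Suc a) * of_real b = of_nat a * M (a - 1) - \<i> * of_real t * M a" for a
  proof -
    let ?g = "\<lambda>x. of_nat a * (complex_of_real x ^ (a-1) * E x)
         - of_real b * (complex_of_real x ^ Suc a * E x) - \<i> * of_real t * (complex_of_real x ^ a * E x)"
    have "(\<integral>x. ?g x \<partial>lborel) = 0"
    proof (rule lborel_integral_of_derivative_zero[where F = "\<lambda>x. complex_of_real x ^ a * E x"])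
      fix x
      have "((\<lambda>x. complex_of_real x ^ a) has_vector_derivative of_nat a * of_real x ^ (a - 1)) (at x)"
        by (rule has_vector_derivative_real_field) (auto intro!: derivative_eq_intros)
      from has_vector_derivative_mult[OF this dE[of x]]
      show "((\<lambda>x. complex_of_real x ^ a * E x) has_vector_derivative ?g x) (at x)"
        by (simp add: algebra_simps)
      show "isCont ?g x" by (intro continuous_intros contE)
      show "integrable lborel ?g"
        by (intro Bochner_Integration.integrable_diff integrable_mult_right int)
    qed (use tend in auto)
    moreover have "(\<integral>x. ?g x \<partial>lborel) = of_nat a * M (a - 1) - of_real b * M (Suc a) - \<i> * of_real t * M a"
      unfolding M_def
      by (subst Bochner_Integration.integral_diff, (intro Bochner_Integration.integrable_diff integrable_mult_right int)+)+
         (simp add: int del: power_Suc)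
    ultimately show ?thesis by (simp add: algebra_simps)
  qed
  have bc: "complex_of_real b \<noteq> 0" using b by simp
  have "M a = (-\<i>) ^ a * complex_of_real (2 * pi * (poly (hermite b a) t * normal_density 0 (sqrt b) t)) \<and>
     M (Suc a) = (-\<i>) ^ (Suc a) * complex_of_real (2 * pi * (poly (hermite b (Suc a)) t * normal_density 0 (sqrt b) t))" for a
  proof (induction a)
    case 0
    have M0: "M 0 = complex_of_real (2 * pi * normal_density 0 (sqrt b) t)"
      using fourier_gaussian[OF b] by (simp add: M_def E_def)
    then show ?case using rec[of 0] bc by (simp add: field_simps)
  next
    case (Suc a)
    have "M (Suc (Suc a)) = (of_nat (Suc a) * M a - \<i> * of_real t * M (Suc a)) / of_real b"
      using rec[of "Suc a"] bc by (simp add: field_simps)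
    also have "\<dots> = (-\<i>) ^ (Suc (Suc a)) * complex_of_real (2 * pi * (poly (hermite b (Suc (Suc a))) t * normal_density 0 (sqrt b) t))"
      unfolding Suc[THEN conjunct1] Suc[THEN conjunct2] hermite_three_term using bc
      by (simp add: field_simps del: hermite.simps)
    finally show ?case using Suc by simp
  qed
  then show ?thesis unfolding M_def E_def by blast
qed

subsection \<open>Fourier transform of a form against an isotropic Gaussian\<close>

text \<open>The transform \<open>chi\<close> freed of its Gaussian weight, which is put into the
  argument instead so that it can be merged with the exponentials of f.\<close>

definition ft :: "nat \<Rightarrow> ((nat \<Rightarrow> real) \<Rightarrow> complex) \<Rightarrow> (nat \<Rightarrow> real) \<Rightarrow> complex" where
  "ft d g t = complex_of_real (1 / (2 * pi) ^ d) * (\<integral>X. g X * exp (- (\<i> * complex_of_real (dotp d t X))) \<partial>Rd d)"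

definition tens :: "nat \<Rightarrow> nat \<Rightarrow> ((nat \<Rightarrow> nat) \<Rightarrow> real) \<Rightarrow> (nat \<Rightarrow> real) \<Rightarrow> real" where
  "tens d r T X = (\<Sum>i\<in>tidx d r. T i * (\<Prod>l<r. X (i l)))"

text \<open>The exponent of X n in the monomial that belongs to the tuple i.\<close>

definition cnt :: "nat \<Rightarrow> (nat \<Rightarrow> nat) \<Rightarrow> nat \<Rightarrow> nat" where
  "cnt r i n = card {l\<in>{..<r}. i l = n}"

text \<open>The parameter b is a precision in \<open>gw\<close> and a variance in its Fourier dual \<open>gdens\<close>.\<close>
definition gw :: "nat \<Rightarrow> real \<Rightarrow> (nat \<Rightarrow> real) \<Rightarrow> real" where
  "gw d b X = exp (- (b/2) * sqnorm d X)"

definition gdens :: "nat \<Rightarrow> real \<Rightarrow> (nat \<Rightarrow> real) \<Rightarrow> real" where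
  "gdens d b t = (\<Prod>n<d. normal_density 0 (sqrt b) (t n))"

text \<open>The form with every power of a coordinate replaced by the Hermite polynomial of that
  degree.\<close>

definition hermite_tens :: "nat \<Rightarrow> nat \<Rightarrow> real \<Rightarrow> ((nat \<Rightarrow> nat) \<Rightarrow> real) \<Rightarrow> (nat \<Rightarrow> real) \<Rightarrow> real" where
  "hermite_tens d r b T t = (\<Sum>i\<in>tidx d r. T i * (\<Prod>n<d. poly (hermite b (cnt r i n)) (t n)))"

interpretation lborel_prod: product_sigma_finite "\<lambda>_::nat. lborel :: real measure"
  by standard

lemma sigma_finite_Rd: "sigma_finite_measure (Rd d)"
proof -
  interpret finite_product_sigma_finite "\<lambda>_::nat. lborel :: real measure" "{..<d}"
    by standard simp
  show ?thesis unfolding Rd_def by (rule sigma_finite_measure_axioms)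
qed

lemma measurable_Rd_component [measurable]: "i < d \<Longrightarrow> (\<lambda>X. X i) \<in> borel_measurable (Rd d)"
  using measurable_component_singleton[of i "{..<d}" "\<lambda>_. lborel :: real measure"]
  unfolding Rd_def by simp

lemma measurable_dotp [measurable]: "dotp d v \<in> borel_measurable (Rd d)"
  unfolding dotp_def[abs_def] by measurable

lemma measurable_sqnorm [measurable]: "sqnorm d \<in> borel_measurable (Rd d)"
  unfolding sqnorm_def[abs_def] by measurable

lemma measurable_quadf [measurable]: "quadf d S \<in> borel_measurable (Rd d)"
  unfolding quadf_def[abs_def] by measurable

lemma measurable_gw [measurable]: "gw d b \<in> borel_measurable (Rd d)"
  unfolding gw_def[abs_def] by measurable

lemma measurable_gdens [measurable]: "gdens d b \<in> borel_measurable (Rd d)"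
  unfolding gdens_def[abs_def] by measurable

lemma measurable_poly [measurable]: "poly (p :: real poly) \<in> borel_measurable borel"
  by (intro borel_measurable_continuous_onI continuous_intros)

lemma measurable_hermite_tens [measurable]: "hermite_tens d r b T \<in> borel_measurable (Rd d)"
  unfolding hermite_tens_def[abs_def] by measurable

lemma finite_tidx [simp]: "finite (tidx d r)"
  unfolding tidx_def by (intro finite_PiE) auto

lemma tidx_less: "i \<in> tidx d r \<Longrightarrow> l < r \<Longrightarrow> i l < d"
  unfolding tidx_def by (auto simp: PiE_iff)

lemma measurable_tens [measurable]: "tens d r T \<in> borel_measurable (Rd d)"
  unfolding tens_def[abs_def] by (measurable; auto intro: tidx_less)

text \<open>Groups the positions of i by their value. Applied to a constant f it says that the
  exponents add up to r.\<close>

lemma prod_tuple: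
  fixes f :: "nat \<Rightarrow> 'a::comm_monoid_mult"
  assumes "i \<in> tidx d r"
  shows "(\<Prod>l<r. f (i l)) = (\<Prod>n<d. f n ^ cnt r i n)"
proof -
  have "(\<Prod>n<d. \<Prod>l\<in>{l\<in>{..<r}. i l = n}. f (i l)) = (\<Prod>l<r. f (i l))"
    using tidx_less[OF assms] by (intro prod.group) auto
  moreover have "(\<Prod>l\<in>{l\<in>{..<r}. i l = n}. f (i l)) = f n ^ cnt r i n" for n
    unfolding cnt_def by (subst prod.cong[where h = "\<lambda>_. f n"]) (auto simp del: prod.cong)
  ultimately show ?thesis by simp
qed

section \<open>Separation of variables in the Fourier integral of a monomial\<close>

lemma cexp_separable:
  "complex_of_real (gw d b X) * exp (- (\<i> * complex_of_real (dotp d t X))) =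
    (\<Prod>n<d. exp (complex_of_real (- (b/2) * (X n)\<^sup>2) - \<i> * complex_of_real (t n * X n)))"
proof -
  have "complex_of_real (gw d b X) = exp (complex_of_real (- (b/2) * sqnorm d X))"
    unfolding gw_def by (simp only: exp_of_real)
  then have "complex_of_real (gw d b X) * exp (- (\<i> * complex_of_real (dotp d t X))) =
      exp (\<Sum>n<d. complex_of_real (- (b/2) * (X n)\<^sup>2) - \<i> * complex_of_real (t n * X n))"
    by (simp add: exp_add[symmetric] sqnorm_def dotp_def sum_subtractf sum_distrib_left sum_negf)
  then show ?thesis by (simp add: exp_sum)
qed

lemma monomial_separable:
  assumes "i \<in> tidx d r"
  shows "complex_of_real ((\<Prod>l<r. X (i l)) * gw d b X) * exp (- (\<i> * complex_of_real (dotp d t X))) =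
    (\<Prod>n<d. complex_of_real (X n) ^ cnt r i n * exp (complex_of_real (- (b/2) * (X n)\<^sup>2) - \<i> * complex_of_real (t n * X n)))"
  unfolding prod.distrib cexp_separable[symmetric] prod_tuple[OF assms] by simp

lemma integrable_monomial_gaussian:
  assumes b: "0 < b" and i: "i \<in> tidx d r"
  shows "integrable (Rd d) (\<lambda>X. complex_of_real ((\<Prod>l<r. X (i l)) * gw d b X) * exp (- (\<i> * complex_of_real (dotp d t X))))"
  unfolding monomial_separable[OF i] Rd_def
  by (rule lborel_prod.product_integrable_prod[OF finite_lessThan integrable_complex_power_gaussian[OF b]])

lemma ft_monomial:
  assumes b: "0 < b" and i: "i \<in> tidx d r"
  shows "(\<integral>X. complex_of_real ((\<Prod>l<r. X (i l)) * gw d b X) * exp (- (\<i> * complex_of_real (dotp d t X))) \<partial>Rd d)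
    = (-\<i>) ^ r * complex_of_real ((2 * pi) ^ d * ((\<Prod>n<d. poly (hermite b (cnt r i n)) (t n)) * gdens d b t))"
proof -
  have "(\<integral>X. complex_of_real ((\<Prod>l<r. X (i l)) * gw d b X) * exp (- (\<i> * complex_of_real (dotp d t X))) \<partial>Rd d)
    = (\<Prod>n<d. \<integral>x. complex_of_real x ^ cnt r i n * exp (complex_of_real (- (b/2) * x\<^sup>2) - \<i> * complex_of_real (t n * x)) \<partial>lborel)"
    unfolding monomial_separable[OF i] Rd_def
    by (rule lborel_prod.product_integral_prod[OF finite_lessThan integrable_complex_power_gaussian[OF b]])
  also have "\<dots> = (\<Prod>n<d. (-\<i>) ^ cnt r i n) * complex_of_real ((2 * pi) ^ d * ((\<Prod>n<d. poly (hermite b (cnt r i n)) (t n)) * gdens d b t))"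
    unfolding fourier_power_gaussian[OF b] by (simp add: prod.distrib gdens_def)
  also have "(\<Prod>n<d. (-\<i>) ^ cnt r i n) = (-\<i>) ^ r"
    using prod_tuple[OF i, of "\<lambda>_. -\<i>"] by simp
  finally show ?thesis .
qed

lemma integrable_tens_gaussian_fourier:
  assumes b: "0 < b"
  shows "integrable (Rd d) (\<lambda>X. complex_of_real (tens d r T X * gw d b X) * exp (- (\<i> * complex_of_real (dotp d t X))))"
proof -
  have "integrable (Rd d) (\<lambda>X. \<Sum>i\<in>tidx d r. complex_of_real (T i) * (complex_of_real ((\<Prod>l<r. X (i l)) * gw d b X) * exp (- (\<i> * complex_of_real (dotp d t X)))))"
    by (intro Bochner_Integration.integrable_sum integrable_mult_right integrable_monomial_gaussian b)
  then show ?thesis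
    by (simp add: tens_def sum_distrib_right mult.assoc)
qed

lemma integrable_tens_gaussian:
  assumes b: "0 < b"
  shows "integrable (Rd d) (\<lambda>X. tens d r T X * gw d b X)"
  using integrable_tens_gaussian_fourier[OF b, of d r T "\<lambda>_. 0"] integrable_Re[of "Rd d"]
  by (fastforce simp: dotp_def simp del: of_real_mult)

lemma ft_tens_gaussian:
  assumes b: "0 < b"
  shows "ft d (\<lambda>X. complex_of_real (tens d r T X * gw d b X)) t =
    (-\<i>) ^ r * complex_of_real (hermite_tens d r b T t * gdens d b t)"
proof -
  have "(\<integral>X. complex_of_real (tens d r T X * gw d b X) * exp (- (\<i> * complex_of_real (dotp d t X))) \<partial>Rd d)
    = (\<integral>X. (\<Sum>i\<in>tidx d r. complex_of_real (T i) * (complex_of_real ((\<Prod>l<r. X (i l)) * gw d b X) * exp (- (\<i> * complex_of_real (dotp d t X))))) \<partial>Rd d)"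
    by (simp add: tens_def sum_distrib_right mult.assoc)
  also have "\<dots> = (\<Sum>i\<in>tidx d r. complex_of_real (T i) * ((-\<i>) ^ r * complex_of_real ((2 * pi) ^ d * ((\<Prod>n<d. poly (hermite b (cnt r i n)) (t n)) * gdens d b t))))"
    by (subst Bochner_Integration.integral_sum)
       (auto intro!: integrable_mult_right integrable_monomial_gaussian b sum.cong simp: ft_monomial[OF b] simp del: of_real_mult)
  also have "\<dots> = complex_of_real ((2*pi)^d) * ((-\<i>) ^ r * complex_of_real (hermite_tens d r b T t * gdens d b t))"
    by (simp add: hermite_tens_def sum_distrib_right sum_distrib_left mult_ac)
  finally show ?thesis unfolding ft_def by simp
qed

text \<open>For tuples in \<open>tidx d r\<close>: i and j are rearrangements of each other, so
  their monomials agree.\<close>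

definition same_type :: "nat \<Rightarrow> nat \<Rightarrow> (nat \<Rightarrow> nat) \<Rightarrow> (nat \<Rightarrow> nat) \<Rightarrow> bool" where
  "same_type d r i j \<longleftrightarrow> (\<forall>n<d. cnt r i n = cnt r j n)"

lemma hermite_product_integral:
  assumes b: "0 < b" and i: "i \<in> tidx d r"
  shows "has_bochner_integral (Rd d)
      (\<lambda>t. (\<Prod>n<d. poly (hermite b (cnt r i n)) (t n)) * (\<Prod>n<d. poly (hermite b (cnt r j n)) (t n)) * gdens d b t)
      (if same_type d r i j then (\<Prod>n<d. fact (cnt r i n)) / b ^ r else 0)"
proof -
  let ?f = "\<lambda>n x. normal_density 0 (sqrt b) x * poly (hermite b (cnt r i n) * hermite b (cnt r j n)) x"
  have eq: "(\<lambda>t. (\<Prod>n<d. poly (hermite b (cnt r i n)) (t n)) * (\<Prod>n<d. poly (hermite b (cnt r j n)) (t n)) * gdens d b t)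
     = (\<lambda>t. \<Prod>n<d. ?f n (t n))"
    by (simp add: gdens_def prod.distrib mult_ac)
  have "(\<integral>t. (\<Prod>n<d. ?f n (t n)) \<partial>Rd d) = (\<Prod>n<d. \<integral>x. ?f n x \<partial>lborel)"
    unfolding Rd_def by (rule lborel_prod.product_integral_prod) (auto intro!: integrable_normal_poly b simp del: poly_mult)
  also have "\<dots> = (\<Prod>n<d. if cnt r i n = cnt r j n then fact (cnt r i n) / b ^ cnt r i n else 0)"
    by (intro prod.cong refl) (subst hermite_orthogonal[OF b], simp)
  also have "\<dots> = (if same_type d r i j then (\<Prod>n<d. fact (cnt r i n) / b ^ cnt r i n) else 0)"
    unfolding same_type_def by (auto intro!: prod.cong prod_zero)
  also have "(\<Prod>n<d. fact (cnt r i n) / b ^ cnt r i n) = (\<Prod>n<d. fact (cnt r i n)) / b ^ r"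
    using prod_tuple[OF i, of "\<lambda>_. b"] by (simp add: prod_dividef)
  finally show ?thesis
    unfolding eq has_bochner_integral_iff
    by (auto simp: Rd_def intro!: lborel_prod.product_integrable_prod integrable_normal_poly b simp del: poly_mult)
qed

lemma hermite_tens_square_integral:
  assumes b: "0 < b"
  shows "has_bochner_integral (Rd d) (\<lambda>t. (hermite_tens d r b T t)\<^sup>2 * gdens d b t)
    (\<Sum>i\<in>tidx d r. \<Sum>j\<in>tidx d r. T i * T j * (if same_type d r i j then (\<Prod>n<d. fact (cnt r i n)) / b ^ r else 0))"
proof -
  have "(\<lambda>t. (hermite_tens d r b T t)\<^sup>2 * gdens d b t) =
     (\<lambda>t. \<Sum>i\<in>tidx d r. \<Sum>j\<in>tidx d r. T i * T j * ((\<Prod>n<d. poly (hermite b (cnt r i n)) (t n)) * (\<Prod>n<d. poly (hermite b (cnt r j n)) (t n)) * gdens d b t))"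
    by (simp add: hermite_tens_def power2_eq_square sum_distrib_left sum_distrib_right mult_ac)
  then show ?thesis
    by (simp only:) (intro has_bochner_integral_sum has_bochner_integral_mult_right hermite_product_integral b)
qed

lemma gdens_nonneg [simp]: "0 \<le> gdens d b t"
  unfolding gdens_def by (intro prod_nonneg) auto

lemma nn_integral_gdens:
  assumes b: "0 < b"
  shows "(\<integral>\<^sup>+t. ennreal (gdens d b t) \<partial>Rd d) = 1"
proof -
  have "(\<integral>\<^sup>+t. (\<Prod>n<d. ennreal (normal_density 0 (sqrt b) (t n))) \<partial>Rd d)
      = (\<Prod>n<d. \<integral>\<^sup>+x. ennreal (normal_density 0 (sqrt b) x) \<partial>lborel)"
    unfolding Rd_def by (rule lborel_prod.product_nn_integral_prod) auto
  also have "(\<integral>\<^sup>+x. ennreal (normal_density 0 (sqrt b) x) \<partial>lborel) = 1"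
    using b by (subst nn_integral_eq_integral) (auto intro!: integrable_normal_density simp: integral_normal_density)
  finally show ?thesis by (simp add: gdens_def prod_ennreal)
qed

text \<open>A rearrangement of i takes only values that i takes, and there are at most r of these.
  This is one of the two places where dependence on d is avoided.\<close>

lemma card_same_type:
  assumes i: "i \<in> tidx d r"
  shows "card {j\<in>tidx d r. same_type d r i j} \<le> r ^ r"
proof -
  have "{j\<in>tidx d r. same_type d r i j} \<subseteq> {..<r} \<rightarrow>\<^sub>E i ` {..<r}"
  proof (rule subsetI)
    fix j assume "j \<in> {j\<in>tidx d r. same_type d r i j}"
    then have j: "j \<in> tidx d r" "same_type d r i j" by auto
    have "j l \<in> i ` {..<r}" if l: "l < r" for l
    proof -
      have "cnt r j (j l) > 0" using l by (auto simp: cnt_def card_gt_0_iff)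
      then have "cnt r i (j l) > 0" using j tidx_less[OF j(1) l] by (simp add: same_type_def)
      then obtain x where "x < r" "i x = j l" by (auto simp: cnt_def card_gt_0_iff)
      then show ?thesis by (metis image_eqI lessThan_iff)
    qed
    then show "j \<in> {..<r} \<rightarrow>\<^sub>E i ` {..<r}" using j(1) by (auto simp: tidx_def PiE_iff)
  qed
  then have "card {j\<in>tidx d r. same_type d r i j} \<le> card ({..<r} \<rightarrow>\<^sub>E i ` {..<r})"
    by (intro card_mono finite_PiE) auto
  also have "\<dots> = card (i ` {..<r}) ^ r" by (simp add: card_PiE)
  also have "\<dots> \<le> r ^ r" by (intro power_mono) (use card_image_le[of "{..<r}" i] in auto)
  finally show ?thesis .
qed

text \<open>Each factorial is at most r to the power of its exponent, and the exponents add up to r,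
  so the number of factors d leaves no trace.\<close>

lemma prod_fact_cnt_le:
  assumes i: "i \<in> tidx d r"
  shows "(\<Prod>n<d. fact (cnt r i n)) \<le> (real r) ^ r"
proof -
  have "(\<Prod>n<d. fact (cnt r i n)) \<le> (\<Prod>n<d. real r ^ cnt r i n)"
  proof (intro prod_mono conjI)
    fix n
    have "cnt r i n \<le> r" unfolding cnt_def using card_mono[of "{..<r}" "{l\<in>{..<r}. i l = n}"] by auto
    then have "real (cnt r i n) ^ cnt r i n \<le> real r ^ cnt r i n" by (intro power_mono) auto
    moreover have "fact (cnt r i n) \<le> real (cnt r i n) ^ cnt r i n"
      using fact_le_power[of "cnt r i n", where 'a = real] by simp
    ultimately show "fact (cnt r i n) \<le> real r ^ cnt r i n" by simp
  qed simp
  also have "\<dots> = real r ^ r" using prod_tuple[OF i, of "\<lambda>_. real r"] by simp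
  finally show ?thesis .
qed

text \<open>Without symmetry of T the quadratic form has off-diagonal entries within each type.
  Bounding T i T j by half the sum of the squares charges every square at most r^r times, once per
  rearrangement; the other r^r bounds the factorials.\<close>

lemma hermite_tens_square_le:
  assumes b: "0 < b"
  shows "(\<Sum>i\<in>tidx d r. \<Sum>j\<in>tidx d r. T i * T j * (if same_type d r i j then (\<Prod>n<d. fact (cnt r i n)) / b ^ r else 0))
    \<le> ((real r ^ r / sqrt b ^ r) * L2_set T (tidx d r))\<^sup>2"
proof -
  let ?I = "tidx d r" and ?K = "real r ^ r / b ^ r"
  have sym: "same_type d r i j \<longleftrightarrow> same_type d r j i" for i j by (auto simp: same_type_def)
  have K: "?K \<ge> 0" using b by simp
  have one: "(\<Sum>j\<in>?I. if same_type d r i j then ?K * (T i)\<^sup>2 / 2 else 0) \<le> real r ^ r * (?K * (T i)\<^sup>2 / 2)" if "i \<in> ?I" for i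
  proof -
    have "(\<Sum>j\<in>?I. if same_type d r i j then ?K * (T i)\<^sup>2 / 2 else 0) = real (card {j\<in>?I. same_type d r i j}) * (?K * (T i)\<^sup>2 / 2)"
      by (simp add: sum.If_cases Int_def)
    also have "\<dots> \<le> real (r ^ r) * (?K * (T i)\<^sup>2 / 2)"
      using card_same_type[OF that] b by (intro mult_right_mono) (simp_all del: of_nat_power)
    finally show ?thesis by simp
  qed
  have "(\<Sum>i\<in>?I. \<Sum>j\<in>?I. T i * T j * (if same_type d r i j then (\<Prod>n<d. fact (cnt r i n)) / b ^ r else 0))
    \<le> (\<Sum>i\<in>?I. \<Sum>j\<in>?I. (if same_type d r i j then ?K * (T i)\<^sup>2 / 2 else 0) + (if same_type d r j i then ?K * (T j)\<^sup>2 / 2 else 0))"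
  proof (intro sum_mono)
    fix i j assume i: "i \<in> ?I" and j: "j \<in> ?I"
    have c: "0 \<le> (\<Prod>n<d. fact (cnt r i n)) / b ^ r" "(\<Prod>n<d. fact (cnt r i n)) / b ^ r \<le> ?K"
      using b prod_fact_cnt_le[OF i] by (auto intro!: divide_right_mono divide_nonneg_nonneg prod_nonneg)
    have "T i * T j \<le> ((T i)\<^sup>2 + (T j)\<^sup>2) / 2"
      using sum_squares_bound[of "T i" "T j"] by simp
    then have "T i * T j * ((\<Prod>n<d. fact (cnt r i n)) / b ^ r) \<le> ((T i)\<^sup>2 + (T j)\<^sup>2) / 2 * ((\<Prod>n<d. fact (cnt r i n)) / b ^ r)"
      using c(1) by (rule mult_right_mono)
    also have "\<dots> \<le> ((T i)\<^sup>2 + (T j)\<^sup>2) / 2 * ?K"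
      using c(2) by (rule mult_left_mono) simp
    finally have "T i * T j * ((\<Prod>n<d. fact (cnt r i n)) / b ^ r) \<le> ?K * (T i)\<^sup>2 / 2 + ?K * (T j)\<^sup>2 / 2"
      by (simp add: algebra_simps add_divide_distrib)
    then show "T i * T j * (if same_type d r i j then (\<Prod>n<d. fact (cnt r i n)) / b ^ r else 0) \<le>
      (if same_type d r i j then ?K * (T i)\<^sup>2 / 2 else 0) + (if same_type d r j i then ?K * (T j)\<^sup>2 / 2 else 0)"
      by (simp add: sym[of j i])
  qed
  also have "\<dots> = (\<Sum>i\<in>?I. \<Sum>j\<in>?I. (if same_type d r i j then ?K * (T i)\<^sup>2 / 2 else 0)) + (\<Sum>j\<in>?I. \<Sum>i\<in>?I. (if same_type d r j i then ?K * (T j)\<^sup>2 / 2 else 0))"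
    unfolding sum.distrib by (rule arg_cong2[where f = "(+)", OF refl sum.swap])
  also have "\<dots> \<le> (\<Sum>i\<in>?I. real r ^ r * (?K * (T i)\<^sup>2 / 2)) + (\<Sum>i\<in>?I. real r ^ r * (?K * (T i)\<^sup>2 / 2))"
    by (intro add_mono sum_mono one)
  also have "\<dots> = real r ^ r * ?K * (\<Sum>i\<in>?I. (T i)\<^sup>2)"
    unfolding sum.distrib[symmetric] by (simp add: sum_distrib_left sum_divide_distrib mult_ac)
  also have "\<dots> = ((real r ^ r / sqrt b ^ r) * L2_set T ?I)\<^sup>2"
  proof -
    have "(sqrt b ^ r)\<^sup>2 = b ^ r" using b by (simp add: power_even_eq[symmetric] power_mult[symmetric] mult.commute[of r 2] power_mult[of _ 2 r])
    then show ?thesis by (simp add: L2_set_def power_mult_distrib power_divide sum_nonneg power2_eq_square[of "real r ^ r"])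
  qed
  finally show ?thesis .
qed

text \<open>Cauchy-Schwarz, with the density split into two square roots: one factor has L2 norm 1
  because the density is a probability density, the other is the weighted L2 norm of the Hermite
  expansion.\<close>

lemma L1norm_ft_tens_gaussian:
  assumes b: "0 < b"
  shows "L1norm d (ft d (\<lambda>X. complex_of_real (tens d r T X * gw d b X))) \<le>
    ennreal ((real r ^ r / sqrt b ^ r) * L2_set T (tidx d r))"
proof -
  let ?W = "hermite_tens d r b T" and ?B = "(real r ^ r / sqrt b ^ r) * L2_set T (tidx d r)"
  have B: "?B \<ge> 0" using b by (auto simp: L2_set_nonneg)
  have "L1norm d (ft d (\<lambda>X. complex_of_real (tens d r T X * gw d b X))) = (\<integral>\<^sup>+t. ennreal \<bar>?W t * sqrt (gdens d b t)\<bar> * ennreal (sqrt (gdens d b t)) \<partial>Rd d)"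
    unfolding L1norm_def ft_tens_gaussian[OF b]
    by (intro nn_integral_cong) (simp add: norm_mult norm_power abs_mult mult.assoc flip: ennreal_mult')
  moreover have "\<dots>\<^sup>2 \<le> (\<integral>\<^sup>+t. (ennreal \<bar>?W t * sqrt (gdens d b t)\<bar>)\<^sup>2 \<partial>Rd d) * (\<integral>\<^sup>+t. (ennreal (sqrt (gdens d b t)))\<^sup>2 \<partial>Rd d)"
    by (rule Cauchy_Schwarz_nn_integral) measurable
  moreover have "(\<integral>\<^sup>+t. (ennreal (sqrt (gdens d b t)))\<^sup>2 \<partial>Rd d) = 1"
    by (simp add: ennreal_power nn_integral_gdens[OF b])
  moreover have "(\<integral>\<^sup>+t. (ennreal \<bar>?W t * sqrt (gdens d b t)\<bar>)\<^sup>2 \<partial>Rd d) \<le> ennreal (?B\<^sup>2)"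
  proof -
    note h = hermite_tens_square_integral[OF b, of d r T]
    have "(\<integral>\<^sup>+t. (ennreal \<bar>?W t * sqrt (gdens d b t)\<bar>)\<^sup>2 \<partial>Rd d) = (\<integral>\<^sup>+t. ennreal ((?W t)\<^sup>2 * gdens d b t) \<partial>Rd d)"
      by (simp add: ennreal_power power_mult_distrib)
    also have "\<dots> = ennreal (\<integral>t. (?W t)\<^sup>2 * gdens d b t \<partial>Rd d)"
      using h by (intro nn_integral_eq_integral) (auto simp: has_bochner_integral_iff)
    also have "\<dots> \<le> ennreal (?B\<^sup>2)"
      using h hermite_tens_square_le[OF b, where d = d and r = r and T = T] by (intro ennreal_leI) (auto simp: has_bochner_integral_iff)
    finally show ?thesis .
  qed
  ultimately have *: "(L1norm d (ft d (\<lambda>X. complex_of_real (tens d r T X * gw d b X))))\<^sup>2 \<le> ennreal (?B\<^sup>2)"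
    by simp
  show ?thesis
  proof (cases "L1norm d (ft d (\<lambda>X. complex_of_real (tens d r T X * gw d b X)))" rule: ennreal_cases)
    case (real x)
    then have "x\<^sup>2 \<le> ?B\<^sup>2" using * by (simp add: ennreal_power del: power_mult_distrib)
    then have "x \<le> ?B" using B by (rule power2_le_imp_le)
    then show ?thesis using real by (simp add: ennreal_leI)
  next
    case top
    then show ?thesis using * by (simp add: top_unique)
  qed
qed

subsection \<open>Forms given by tensors\<close>

lemma PiE_tuple_eqI:
  assumes "i \<in> tidx d r" "j \<in> tidx d r" "\<And>l. l < r \<Longrightarrow> i l = j l"
  shows "i = j"
  using assms unfolding tidx_def by (auto simp: PiE_iff extensional_def fun_eq_iff) (metis lessThan_iff)

lemma tidx_comp_permutes:
  assumes "i \<in> tidx d r" "\<sigma> permutes {..<r}"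
  shows "i \<circ> \<sigma> \<in> tidx d r"
  using assms permutes_in_image[OF assms(2)]
  by (auto simp: tidx_def PiE_iff extensional_def)

text \<open>Equal counts make the multisets of entries equal, and equal multisets differ by a
  permutation of the positions.\<close>

lemma same_type_imp_permutes:
  assumes i: "i \<in> tidx d r" and j: "j \<in> tidx d r" and st: "same_type d r i j"
  obtains \<sigma> where "\<sigma> permutes {..<r}" "i = j \<circ> \<sigma>"
proof -
  have "count (image_mset f (mset_set {..<r})) n = cnt r f n" for f :: "nat \<Rightarrow> nat" and n
    by (simp add: cnt_def count_image_mset vimage_def Int_def conj_commute)
  moreover have "cnt r i n = cnt r j n" for n
  proof (cases "n < d")
    case False
    then have "cnt r i n = 0" "cnt r j n = 0"
      using tidx_less[OF i] tidx_less[OF j] by (auto simp: cnt_def card_eq_0_iff)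
    then show ?thesis by simp
  qed (use st in \<open>simp add: same_type_def\<close>)
  ultimately have "image_mset i (mset_set {..<r}) = image_mset j (mset_set {..<r})"
    by (intro multiset_eqI) simp
  then obtain \<sigma> where \<sigma>: "\<sigma> permutes {..<r}" "\<forall>l\<in>{..<r}. i l = j (\<sigma> l)"
    by (rule image_mset_eq_implies_permutes[OF finite_lessThan])
  have "i = j \<circ> \<sigma>"
    using \<sigma> by (intro PiE_tuple_eqI[OF i tidx_comp_permutes[OF j]]) auto
  with \<sigma>(1) show thesis by (rule that)
qed

text \<open>A vanishing form has vanishing Fourier transform against the Gaussian, hence a vanishing
  Hermite expansion, and orthogonality of the Hermite polynomials then isolates the coefficients.\<close>
lemma symmetric_tensor_eq_0:
  assumes sym: "\<And>i \<sigma>. i \<in> tidx d r \<Longrightarrow> \<sigma> permutes {..<r} \<Longrightarrow> T (i \<circ> \<sigma>) = T i"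
    and zero: "\<And>X. tens d r T X = 0" and i: "i \<in> tidx d r"
  shows "T i = 0"
proof -
  have "hermite_tens d r 1 T t = 0" for t
  proof -
    have "gdens d 1 t > 0" unfolding gdens_def by (intro prod_pos) (auto intro: normal_density_pos)
    then have "gdens d 1 t \<noteq> 0" by simp
    moreover have "ft d (\<lambda>X. complex_of_real (tens d r T X * gw d 1 X)) t = 0"
      by (simp add: zero ft_def)
    ultimately show ?thesis unfolding ft_tens_gaussian[OF zero_less_one] by simp
  qed
  then have "(\<Sum>i\<in>tidx d r. \<Sum>j\<in>tidx d r. T i * T j * (if same_type d r i j then (\<Prod>n<d. fact (cnt r i n)) / 1 ^ r else 0)) = 0"
    using hermite_tens_square_integral[of 1 d r T] by (auto simp: has_bochner_integral_iff)
  \<comment> \<open>A symmetric T is constant on each type, so the double sum turns into a sum of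
    nonnegative terms, all of which must vanish; the term j = i then gives the claim.\<close>
  moreover have "T i * T j * (if same_type d r i j then (\<Prod>n<d. fact (cnt r i n)) / 1 ^ r else 0) =
     (if same_type d r i j then (T i)\<^sup>2 * (\<Prod>n<d. fact (cnt r i n)) else 0)"
    if ij: "i \<in> tidx d r" "j \<in> tidx d r" for i j
  proof (cases "same_type d r i j")
    case True
    from same_type_imp_permutes[OF ij True] obtain \<sigma> where "\<sigma> permutes {..<r}" "i = j \<circ> \<sigma>" .
    then have "T i = T j" using sym[OF ij(2)] by simp
    then show ?thesis by (simp add: power2_eq_square)
  qed simp
  ultimately have eq: "(\<Sum>i\<in>tidx d r. \<Sum>j\<in>tidx d r. if same_type d r i j then (T i)\<^sup>2 * (\<Prod>n<d. fact (cnt r i n)) else 0) = 0"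
    by simp
  have "(\<Sum>j\<in>tidx d r. if same_type d r i j then (T i)\<^sup>2 * (\<Prod>n<d. fact (cnt r i n)) else 0) = 0"
    using eq i by (subst (asm) sum_nonneg_eq_0_iff) (auto intro!: sum_nonneg mult_nonneg_nonneg prod_nonneg)
  then have "(if same_type d r i i then (T i)\<^sup>2 * (\<Prod>n<d. fact (cnt r i n)) else 0) = 0"
    using i by (subst (asm) sum_nonneg_eq_0_iff) (auto intro!: mult_nonneg_nonneg prod_nonneg)
  then show ?thesis by (simp add: same_type_def)
qed

section \<open>Symmetrization and the tensor behind \<open>vnorm\<close>\<close>

definition symmetrize :: "nat \<Rightarrow> nat \<Rightarrow> ((nat \<Rightarrow> nat) \<Rightarrow> real) \<Rightarrow> (nat \<Rightarrow> nat) \<Rightarrow> real" where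
  "symmetrize d r T i = (if i \<in> tidx d r then (\<Sum>\<sigma> | \<sigma> permutes {..<r}. T (i \<circ> \<sigma>)) / fact r else 0)"

lemma symmetrize_permute:
  assumes i: "i \<in> tidx d r" and \<sigma>: "\<sigma> permutes {..<r}"
  shows "symmetrize d r T (i \<circ> \<sigma>) = symmetrize d r T i"
proof -
  have "(\<Sum>\<tau> | \<tau> permutes {..<r}. T (i \<circ> \<sigma> \<circ> \<tau>)) = (\<Sum>\<tau> | \<tau> permutes {..<r}. T (i \<circ> \<tau>))"
    using setum_permutations_compose_left[OF \<sigma>, of "\<lambda>\<tau>. T (i \<circ> \<tau>)"] by (simp add: comp_assoc)
  then show ?thesis
    using tidx_comp_permutes[OF assms] i by (simp add: symmetrize_def)
qed

lemma tens_symmetrize: "tens d r (symmetrize d r T) X = tens d r T X"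
proof -
  \<comment> \<open>Permuting positions leaves the monomial unchanged, so every summand of the
    symmetrization represents the same form.\<close>
  have perm: "(\<Sum>i\<in>tidx d r. T (i \<circ> \<sigma>) * (\<Prod>l<r. X (i l))) = tens d r T X" if \<sigma>: "\<sigma> permutes {..<r}" for \<sigma>
    unfolding tens_def
  proof (rule sum.reindex_bij_witness[where i = "\<lambda>i. i \<circ> inv \<sigma>" and j = "\<lambda>i. i \<circ> \<sigma>"])
    fix i assume "i \<in> tidx d r"
    show "T (i \<circ> \<sigma>) * (\<Prod>l<r. X ((i \<circ> \<sigma>) l)) = T (i \<circ> \<sigma>) * (\<Prod>l<r. X (i l))"
      using prod.permute[OF \<sigma>, of "\<lambda>l. X (i l)"] by (simp add: comp_def)
  qed (use \<sigma> permutes_inv[OF \<sigma>] in \<open>auto simp: comp_assoc permutes_inv_o intro: tidx_comp_permutes\<close>)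
  have "tens d r (symmetrize d r T) X = (\<Sum>i\<in>tidx d r. \<Sum>\<sigma> | \<sigma> permutes {..<r}. T (i \<circ> \<sigma>) * (\<Prod>l<r. X (i l)) / fact r)"
    unfolding tens_def by (intro sum.cong) (auto simp: symmetrize_def sum_distrib_right sum_divide_distrib)
  also have "\<dots> = (\<Sum>\<sigma> | \<sigma> permutes {..<r}. \<Sum>i\<in>tidx d r. T (i \<circ> \<sigma>) * (\<Prod>l<r. X (i l)) / fact r)"
    by (rule sum.swap)
  also have "\<dots> = (\<Sum>\<sigma> | \<sigma> permutes {..<r}. tens d r T X / fact r)"
    by (intro sum.cong) (auto simp: perm simp flip: sum_divide_distrib)
  also have "\<dots> = tens d r T X" by (simp add: card_permutations)
  finally show ?thesis .
qed

text \<open>The tensor T need not be symmetric, so products are represented by plain tensor products.\<close>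
definition trep :: "nat \<Rightarrow> nat \<Rightarrow> ((nat \<Rightarrow> real) \<Rightarrow> real) \<Rightarrow> real \<Rightarrow> bool" where
  "trep d r p B \<longleftrightarrow> (\<exists>T. (\<forall>X. tens d r T X = p X) \<and> L2_set T (tidx d r) \<le> B)"

lemma trepI: "(\<And>X. tens d r T X = p X) \<Longrightarrow> L2_set T (tidx d r) \<le> B \<Longrightarrow> trep d r p B"
  unfolding trep_def by blast

lemma trepE:
  assumes "trep d r p B"
  obtains T where "p = tens d r T" "L2_set T (tidx d r) \<le> B"
  using assms unfolding trep_def by (metis ext)

text \<open>The description in \<open>sym_tensor\<close> needs existence and uniqueness before it
  says anything. Symmetrizing some tensor of p gives the first;
  \<open>symmetric_tensor_eq_0\<close>, applied to a difference, gives the second.\<close>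

lemma trep_vnorm:
  assumes p: "trep d r p B"
  shows "trep d r p (vnorm d r p)"
proof -
  from p obtain T where T: "p = tens d r T" by (rule trepE)
  let ?P = "\<lambda>T. (\<forall>i. i \<notin> tidx d r \<longrightarrow> T i = 0) \<and>
      (\<forall>i\<in>tidx d r. \<forall>\<sigma>. \<sigma> permutes {..<r} \<longrightarrow> T (i \<circ> \<sigma>) = T i) \<and>
      (\<forall>X. (\<Sum>i\<in>tidx d r. T i * (\<Prod>l<r. X (i l))) = p X)"
  have ex: "?P (symmetrize d r T)"
    using tens_symmetrize[of d r T] by (auto simp: T symmetrize_permute tens_def[symmetric]) (simp add: symmetrize_def)
  have uniq: "S = S'" if "?P S" "?P S'" for S S'
  proof
    fix i
    show "S i = S' i"
    proof (cases "i \<in> tidx d r")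
      case True
      have "(\<lambda>i. S i - S' i) i = 0"
      proof (rule symmetric_tensor_eq_0[OF _ _ True])
        show "S (j \<circ> \<sigma>) - S' (j \<circ> \<sigma>) = S j - S' j" if "j \<in> tidx d r" "\<sigma> permutes {..<r}" for j \<sigma>
          using that \<open>?P S\<close> \<open>?P S'\<close> by metis
        show "tens d r (\<lambda>i. S i - S' i) X = 0" for X
          using that by (simp add: tens_def left_diff_distrib sum_subtractf)
      qed
      then show ?thesis by simp
    qed (use that in auto)
  qed
  have "?P (sym_tensor d r p)"
    unfolding sym_tensor_def by (rule theI[of ?P, OF ex]) (rule uniq[OF _ ex])
  then show ?thesis
    by (intro trepI[of d r "sym_tensor d r p"]) (auto simp: tens_def vnorm_def L2_set_def)
qed

section \<open>Calculus of tensor norms\<close>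

lemma trep_nonneg: "trep d r p B \<Longrightarrow> 0 \<le> B"
  by (elim trepE) (use L2_set_nonneg order_trans in blast)

lemma trep_mono: "trep d r p B \<Longrightarrow> B \<le> B' \<Longrightarrow> trep d r p B'"
  unfolding trep_def using order_trans by blast

lemma trep_zero: "trep d r (\<lambda>_. 0) 0"
  by (rule trepI[where T = "\<lambda>_. 0"]) (auto simp: tens_def L2_set_def)

lemma trep_add:
  assumes "trep d r p B" "trep d r q C"
  shows "trep d r (\<lambda>X. p X + q X) (B + C)"
proof -
  from assms obtain T S where T: "p = tens d r T" "L2_set T (tidx d r) \<le> B"
    and S: "q = tens d r S" "L2_set S (tidx d r) \<le> C" by (elim trepE)
  show ?thesis
  proof (rule trepI[where T = "\<lambda>i. T i + S i"])
    show "L2_set (\<lambda>i. T i + S i) (tidx d r) \<le> B + C"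
      using L2_set_triangle_ineq[of T S "tidx d r"] T(2) S(2) by simp
  qed (simp add: T S tens_def distrib_right sum.distrib)
qed

lemma trep_scale:
  assumes "trep d r p B"
  shows "trep d r (\<lambda>X. c * p X) (\<bar>c\<bar> * B)"
proof -
  from assms obtain T where T: "p = tens d r T" "L2_set T (tidx d r) \<le> B" by (elim trepE)
  show ?thesis
  proof (rule trepI[where T = "\<lambda>i. c * T i"])
    have "L2_set (\<lambda>i. c * T i) (tidx d r) = \<bar>c\<bar> * L2_set T (tidx d r)"
      by (simp add: L2_set_def power_mult_distrib real_sqrt_mult flip: sum_distrib_left)
    then show "L2_set (\<lambda>i. c * T i) (tidx d r) \<le> \<bar>c\<bar> * B"
      using T(2) by (simp add: mult_left_mono)
  qed (simp add: T tens_def sum_distrib_left mult_ac)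
qed

lemma trep_diff:
  assumes "trep d r p B" "trep d r q C"
  shows "trep d r (\<lambda>X. p X - q X) (B + C)"
  using trep_add[OF assms(1) trep_scale[OF assms(2), of "-1"]] by simp

text \<open>A tuple of length r + s is cut at position r. The value \<open>undefined\<close> past
  the end makes the joined tuple extensional, as \<open>tidx\<close> demands.\<close>

lemma sum_tidx_add:
  fixes f :: "(nat \<Rightarrow> nat) \<Rightarrow> 'a::comm_monoid_add"
  shows "(\<Sum>i\<in>tidx d (r + s). f i) =
    (\<Sum>(u, v)\<in>tidx d r \<times> tidx d s. f (\<lambda>l. if l < r then u l else if l < r + s then v (l - r) else undefined))"
proof (rule sum.reindex_bij_witness[where
    i = "\<lambda>(u, v). \<lambda>l. if l < r then u l else if l < r + s then v (l - r) else undefined" and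
    j = "\<lambda>i. (\<lambda>l\<in>{..<r}. i l, \<lambda>l\<in>{..<s}. i (l + r))"])
  fix i assume i: "i \<in> tidx d (r + s)"
  show "(case (\<lambda>l\<in>{..<r}. i l, \<lambda>l\<in>{..<s}. i (l + r)) of (u, v) \<Rightarrow> \<lambda>l. if l < r then u l else if l < r + s then v (l - r) else undefined) = i"
    using i by (auto simp: tidx_def PiE_iff extensional_def fun_eq_iff)
  then show "(case (\<lambda>l\<in>{..<r}. i l, \<lambda>l\<in>{..<s}. i (l + r)) of (u, v) \<Rightarrow> f (\<lambda>l. if l < r then u l else if l < r + s then v (l - r) else undefined)) = f i"
    by simp
  show "(\<lambda>l\<in>{..<r}. i l, \<lambda>l\<in>{..<s}. i (l + r)) \<in> tidx d r \<times> tidx d s"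
    using i by (auto simp: tidx_def PiE_iff)
next
  fix w assume "w \<in> tidx d r \<times> tidx d s"
  then obtain u v where w: "w = (u, v)" "u \<in> tidx d r" "v \<in> tidx d s" by auto
  then show "(case w of (u, v) \<Rightarrow> \<lambda>l. if l < r then u l else if l < r + s then v (l - r) else undefined) \<in> tidx d (r + s)"
    by (auto simp: tidx_def PiE_iff extensional_def)
  show "(\<lambda>l\<in>{..<r}. (case w of (u, v) \<Rightarrow> \<lambda>l. if l < r then u l else if l < r + s then v (l - r) else undefined) l,
      \<lambda>l\<in>{..<s}. (case w of (u, v) \<Rightarrow> \<lambda>l. if l < r then u l else if l < r + s then v (l - r) else undefined) (l + r)) = w"
    using w by (auto simp: tidx_def PiE_iff extensional_def fun_eq_iff)
qed

lemma trep_mult: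
  assumes "trep d r p B" "trep d s q C"
  shows "trep d (r + s) (\<lambda>X. p X * q X) (B * C)"
proof -
  from assms obtain T S where T: "p = tens d r T" "L2_set T (tidx d r) \<le> B"
    and S: "q = tens d s S" "L2_set S (tidx d s) \<le> C" by (elim trepE)
  let ?m = "\<lambda>u v l. if l < r then u l else if l < r + s then v (l - r) else undefined :: nat"
  let ?R = "\<lambda>i. T (\<lambda>l\<in>{..<r}. i l) * S (\<lambda>l\<in>{..<s}. i (l + r))"
  have R: "?R (?m u v) = T u * S v" if "u \<in> tidx d r" "v \<in> tidx d s" for u v
  proof -
    have "(\<lambda>l\<in>{..<r}. ?m u v l) = u" "(\<lambda>l\<in>{..<s}. ?m u v (l + r)) = v"
      using that by (auto simp: tidx_def PiE_iff extensional_def fun_eq_iff)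
    then show ?thesis by simp
  qed
  have P: "(\<Prod>l<r + s. X (?m u v l)) = (\<Prod>l<r. X (u l)) * (\<Prod>l<s. X (v l))" for u v and X :: "nat \<Rightarrow> real"
  proof -
    have "(\<Prod>l<r + s. g l) = (\<Prod>l<r. g l) * (\<Prod>l<s. g (r + l))" for g :: "nat \<Rightarrow> real"
      by (induction s) (simp_all add: mult.assoc)
    then show ?thesis by simp
  qed
  show ?thesis
  proof (rule trepI[where T = ?R])
    fix X
    have "tens d (r + s) ?R X = (\<Sum>(u, v)\<in>tidx d r \<times> tidx d s. (T u * S v) * ((\<Prod>l<r. X (u l)) * (\<Prod>l<s. X (v l))))"
      unfolding tens_def sum_tidx_add by (intro sum.cong) (auto simp only: R P split: prod.splits)
    also have "\<dots> = tens d r T X * tens d s S X"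
      unfolding tens_def sum_product sum.cartesian_product[symmetric] by (simp add: mult_ac)
    finally show "tens d (r + s) ?R X = p X * q X" by (simp add: T S)
  next
    have "(\<Sum>i\<in>tidx d (r + s). (?R i)\<^sup>2) = (\<Sum>(u, v)\<in>tidx d r \<times> tidx d s. (T u * S v)\<^sup>2)"
      unfolding sum_tidx_add by (intro sum.cong) (auto simp only: R split: prod.splits)
    also have "\<dots> = (\<Sum>u\<in>tidx d r. (T u)\<^sup>2) * (\<Sum>v\<in>tidx d s. (S v)\<^sup>2)"
      unfolding sum_product sum.cartesian_product[symmetric] by (simp add: power_mult_distrib)
    finally have "L2_set ?R (tidx d (r + s)) = L2_set T (tidx d r) * L2_set S (tidx d s)"
      by (simp add: L2_set_def real_sqrt_mult)
    also have "\<dots> \<le> B * C"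
      using T(2) S(2) by (intro mult_mono) (use L2_set_nonneg order_trans in blast)+
    finally show "L2_set ?R (tidx d (r + s)) \<le> B * C" .
  qed
qed

lemma trep_const: "trep d 0 (\<lambda>_. c) \<bar>c\<bar>"
  by (rule trepI[where T = "\<lambda>_. c"]) (auto simp: tens_def tidx_def L2_set_def)

lemma sum_tidx_1:
  fixes f :: "(nat \<Rightarrow> nat) \<Rightarrow> 'a::comm_monoid_add"
  shows "(\<Sum>i\<in>tidx d 1. f i) = (\<Sum>n<d. f (\<lambda>l. if l = 0 then n else undefined))"
  by (rule sum.reindex_bij_witness[where i = "\<lambda>n l. if l = 0 then n else undefined" and j = "\<lambda>i. i 0"])
     (auto simp: tidx_def PiE_iff extensional_def fun_eq_iff intro!: arg_cong[where f = f])

lemma trep_dotp: "trep d 1 (dotp d v) (sqrt (sqnorm d v))"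
proof (rule trepI[where T = "\<lambda>i. v (i 0)"])
  show "tens d 1 (\<lambda>i. v (i 0)) X = dotp d v X" for X
    unfolding tens_def sum_tidx_1 dotp_def by simp
  show "L2_set (\<lambda>i. v (i 0)) (tidx d 1) \<le> sqrt (sqnorm d v)"
    unfolding L2_set_def sum_tidx_1 sqnorm_def by simp
qed

lemma trep_quadf: "trep d 2 (quadf d S) (sqrt (\<Sum>i<d. \<Sum>l<d. (S i l)\<^sup>2))"
proof (rule trepI[where T = "\<lambda>i. S (i 0) (i 1)"])
  have two: "(2::nat) = 1 + 1" by simp
  show "tens d 2 (\<lambda>i. S (i 0) (i 1)) X = quadf d S X" for X
    unfolding tens_def two sum_tidx_add sum.cartesian_product[symmetric] sum_tidx_1 quadf_def
    by (simp add: lessThan_Suc mult_ac)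
  show "L2_set (\<lambda>i. S (i 0) (i 1)) (tidx d 2) \<le> sqrt (\<Sum>i<d. \<Sum>l<d. (S i l)\<^sup>2)"
    unfolding L2_set_def two sum_tidx_add sum.cartesian_product[symmetric] sum_tidx_1
    by simp
qed

text \<open>Forms of degree r with no norm attached. The coefficients of the given polynomials are
  under no bound, so this is all that can be said of them; it suffices for measurability, for
  integrability and for entering \<open>trep_vnorm\<close>.\<close>

definition hpoly :: "nat \<Rightarrow> nat \<Rightarrow> ((nat \<Rightarrow> real) \<Rightarrow> real) \<Rightarrow> bool" where
  "hpoly d r p \<longleftrightarrow> (\<exists>B. trep d r p B)"

lemma hpoly_add: "hpoly d r p \<Longrightarrow> hpoly d r q \<Longrightarrow> hpoly d r (\<lambda>X. p X + q X)"
  unfolding hpoly_def using trep_add by blast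

lemma hpoly_diff: "hpoly d r p \<Longrightarrow> hpoly d r q \<Longrightarrow> hpoly d r (\<lambda>X. p X - q X)"
  unfolding hpoly_def using trep_diff by blast

lemma hpoly_scale: "hpoly d r p \<Longrightarrow> hpoly d r (\<lambda>X. c * p X)"
  unfolding hpoly_def using trep_scale by blast

lemma hpoly_zero: "hpoly d r (\<lambda>_. 0)"
  unfolding hpoly_def using trep_zero by blast

lemma hpoly_sum: "(\<And>i. i \<in> A \<Longrightarrow> hpoly d r (p i)) \<Longrightarrow> hpoly d r (\<lambda>X. \<Sum>i\<in>A. p i X)"
  by (induction A rule: infinite_finite_induct) (auto simp: hpoly_zero intro: hpoly_add)

lemma hpoly_mult: "hpoly d r p \<Longrightarrow> hpoly d s q \<Longrightarrow> hpoly d (r + s) (\<lambda>X. p X * q X)"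
  unfolding hpoly_def using trep_mult by blast

lemma hpoly_const: "hpoly d 0 (\<lambda>_. c)"
  unfolding hpoly_def using trep_const by blast

lemma hpoly_dotp: "hpoly d 1 (dotp d v)"
  unfolding hpoly_def using trep_dotp by blast

lemma hpoly_quadf: "hpoly d 2 (quadf d S)"
  unfolding hpoly_def using trep_quadf by blast

lemma hpoly_coordinate: "i < d \<Longrightarrow> hpoly d 1 (\<lambda>X. X i)"
  using hpoly_dotp[of d "\<lambda>n. if n = i then 1 else 0"]
  by (simp add: dotp_def[abs_def] if_distrib[where f = "\<lambda>c. c * _"] cong: if_cong)

lemma hpoly_power: "hpoly d r p \<Longrightarrow> hpoly d (n * r) (\<lambda>X. p X ^ n)"
  by (induction n) (auto intro: hpoly_mult hpoly_const)

lemma hpoly_monomial: "hpoly d (\<Sum>i<d. a i) (\<lambda>X. \<Prod>i<d. X i ^ a i)"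
proof -
  have "n \<le> d \<Longrightarrow> hpoly d (\<Sum>i<n. a i) (\<lambda>X. \<Prod>i<n. X i ^ a i)" for n
  proof (induction n)
    case (Suc n)
    then have "hpoly d (a n * 1) (\<lambda>X. X n ^ a n)" by (intro hpoly_power hpoly_coordinate) simp
    with Suc hpoly_mult[of d "\<Sum>i<n. a i" _ "a n"] show ?case by simp
  qed (simp add: hpoly_const)
  then show ?thesis by simp
qed

lemma measurable_hpoly: "hpoly d r p \<Longrightarrow> p \<in> borel_measurable (Rd d)"
  unfolding hpoly_def by (auto elim!: trepE)

lemma integrable_hpoly_gaussian: "hpoly d r p \<Longrightarrow> 0 < b \<Longrightarrow> integrable (Rd d) (\<lambda>X. p X * gw d b X)"
  unfolding hpoly_def by (auto elim!: trepE intro: integrable_tens_gaussian)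

subsection \<open>Contractions of the L1 norm and general Gaussians\<close>

lemma measurable_dotp2 [measurable (raw)]:
  assumes "f \<in> N \<rightarrow>\<^sub>M Rd d" "g \<in> N \<rightarrow>\<^sub>M Rd d"
  shows "(\<lambda>x. dotp d (f x) (g x)) \<in> borel_measurable N"
  unfolding dotp_def
proof (intro borel_measurable_sum borel_measurable_times)
  fix i assume i: "i \<in> {..<d}"
  show "(\<lambda>x. f x i) \<in> borel_measurable N"
    using measurable_compose[OF assms(1) measurable_Rd_component[of i d]] i by simp
  show "(\<lambda>x. g x i) \<in> borel_measurable N"
    using measurable_compose[OF assms(2) measurable_Rd_component[of i d]] i by simp
qed

lemma measurable_ft2:
  assumes [measurable]: "(\<lambda>(w, X). g w X) \<in> borel_measurable (M \<Otimes>\<^sub>M Rd d)"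
  shows "(\<lambda>(w, t). ft d (g w) t) \<in> borel_measurable (M \<Otimes>\<^sub>M Rd d)"
proof -
  interpret R: sigma_finite_measure "Rd d" by (rule sigma_finite_Rd)
  show ?thesis unfolding ft_def by measurable
qed

lemma measurable_ft:
  assumes [measurable]: "g \<in> borel_measurable (Rd d)"
  shows "ft d g \<in> borel_measurable (Rd d)"
proof -
  interpret R: sigma_finite_measure "Rd d" by (rule sigma_finite_Rd)
  show ?thesis unfolding ft_def[abs_def] by measurable
qed

lemma integrable_mult_phase:
  assumes "integrable M g" "ph \<in> borel_measurable M" "\<And>x. cmod (ph x) = 1"
  shows "integrable M (\<lambda>x. g x * ph x :: complex)"
proof -
  have [measurable]: "g \<in> borel_measurable M" "ph \<in> borel_measurable M" using assms by auto
  show ?thesis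
    by (rule Bochner_Integration.integrable_bound[OF assms(1)]) (auto simp: norm_mult assms(3))
qed

text \<open>Supplies the Fubini condition of \<open>ft_mixture\<close>: a majorant independent of w
  has a finite double integral when M is finite.\<close>

lemma integrable_pair_dominated:
  fixes f :: "'a \<Rightarrow> (nat \<Rightarrow> real) \<Rightarrow> complex"
  assumes M: "finite_measure M" and G: "integrable (Rd d) G"
    and f[measurable]: "(\<lambda>(w, X). f w X) \<in> borel_measurable (M \<Otimes>\<^sub>M Rd d)"
    and le: "AE w in M. \<forall>X. cmod (f w X) \<le> G X"
  shows "integrable (M \<Otimes>\<^sub>M Rd d) (\<lambda>(w, X). f w X)"
proof -
  interpret M: finite_measure M by fact
  interpret R: sigma_finite_measure "Rd d" by (rule sigma_finite_Rd)
  have [measurable]: "G \<in> borel_measurable (Rd d)" using G by auto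
  have "(\<integral>\<^sup>+x. ennreal (norm (case x of (w, X) \<Rightarrow> f w X)) \<partial>(M \<Otimes>\<^sub>M Rd d)) = (\<integral>\<^sup>+w. \<integral>\<^sup>+X. ennreal (cmod (f w X)) \<partial>Rd d \<partial>M)"
    by (subst R.nn_integral_fst[symmetric]) (auto simp: case_prod_beta')
  also have "\<dots> \<le> (\<integral>\<^sup>+w. (\<integral>\<^sup>+X. ennreal (norm (G X)) \<partial>Rd d) \<partial>M)"
    using le by (intro nn_integral_mono_AE) (auto elim!: eventually_mono intro!: nn_integral_mono ennreal_leI order_trans[OF _ abs_ge_self])
  also have "\<dots> = (\<integral>\<^sup>+X. ennreal (norm (G X)) \<partial>Rd d) * emeasure M (space M)" by simp
  also have "\<dots> < \<infinity>"
  proof -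
    have "emeasure M (space M) < \<top>" unfolding less_top[symmetric] by simp
    then show ?thesis using G by (simp add: integrable_iff_bounded ennreal_mult_less_top)
  qed
  finally show ?thesis using f by (auto simp: integrable_iff_bounded)
qed

text \<open>By Fubini the transform of a mixture is the mixture of the transforms, and the norm may
  be taken inside. It serves twice: for random phases and for the integral in variation of
  constants.\<close>

lemma ft_mixture:
  assumes M: "sigma_finite_measure M"
    and int: "integrable (M \<Otimes>\<^sub>M Rd d) (\<lambda>(w, X). g w X)"
  shows "L1norm d (ft d (\<lambda>X. \<integral>w. g w X \<partial>M)) \<le> (\<integral>\<^sup>+w. L1norm d (ft d (g w)) \<partial>M)"
proof -
  interpret M: sigma_finite_measure M by fact
  interpret R: sigma_finite_measure "Rd d" by (rule sigma_finite_Rd)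
  interpret P: pair_sigma_finite M "Rd d" by standard
  have g[measurable]: "(\<lambda>(w, X). g w X) \<in> borel_measurable (M \<Otimes>\<^sub>M Rd d)" using int by auto
  let ?c = "complex_of_real (1 / (2 * pi) ^ d)"
  have "ennreal (cmod (ft d (\<lambda>X. \<integral>w. g w X \<partial>M) t)) \<le> (\<integral>\<^sup>+w. ennreal (cmod (ft d (g w) t)) \<partial>M)" if t: "t \<in> space (Rd d)" for t
  proof -
    let ?ph = "\<lambda>X. exp (- (\<i> * complex_of_real (dotp d t X)))"
    have "integrable (M \<Otimes>\<^sub>M Rd d) (\<lambda>z. (case z of (w, X) \<Rightarrow> g w X) * ?ph (snd z))"
      by (rule integrable_mult_phase[OF int]) simp_all
    then have i2: "integrable (M \<Otimes>\<^sub>M Rd d) (\<lambda>(w, X). ?c * (g w X * ?ph X))"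
      by (auto simp: case_prod_beta' intro!: integrable_mult_right simp del: of_real_divide)
    have "ft d (\<lambda>X. \<integral>w. g w X \<partial>M) t = (\<integral>X. \<integral>w. ?c * (g w X * ?ph X) \<partial>M \<partial>Rd d)"
      unfolding ft_def by (simp del: of_real_divide)
    also have "\<dots> = (\<integral>w. \<integral>X. ?c * (g w X * ?ph X) \<partial>Rd d \<partial>M)"
      by (rule P.Fubini_integral[OF i2])
    also have "\<dots> = (\<integral>w. ft d (g w) t \<partial>M)"
      unfolding ft_def by (simp del: of_real_divide)
    finally have eq: "ft d (\<lambda>X. \<integral>w. g w X \<partial>M) t = (\<integral>w. ft d (g w) t \<partial>M)" .
    have "integrable M (\<lambda>w. ft d (g w) t)"
      using P.integrable_fst[OF i2] unfolding ft_def by (simp del: of_real_divide)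
    then show ?thesis unfolding eq by (rule integral_norm_bound_ennreal)
  qed
  then have "L1norm d (ft d (\<lambda>X. \<integral>w. g w X \<partial>M)) \<le> (\<integral>\<^sup>+t. (\<integral>\<^sup>+w. ennreal (cmod (ft d (g w) t)) \<partial>M) \<partial>Rd d)"
    unfolding L1norm_def by (rule nn_integral_mono)
  also have "\<dots> = (\<integral>\<^sup>+w. (\<integral>\<^sup>+t. ennreal (cmod (ft d (g w) t)) \<partial>Rd d) \<partial>M)"
    using measurable_ft2[OF g] by (intro P.Fubini') (simp add: case_prod_beta')
  finally show ?thesis unfolding L1norm_def .
qed

lemma L1norm_ft_add:
  assumes "integrable (Rd d) g" "integrable (Rd d) h"
  shows "L1norm d (ft d (\<lambda>X. g X + h X)) \<le> L1norm d (ft d g) + L1norm d (ft d h)"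
proof -
  have [measurable]: "g \<in> borel_measurable (Rd d)" "h \<in> borel_measurable (Rd d)" using assms by auto
  have "ft d (\<lambda>X. g X + h X) t = ft d g t + ft d h t" if t: "t \<in> space (Rd d)" for t
  proof -
    have ph: "(\<lambda>X. exp (- (\<i> * complex_of_real (dotp d t X)))) \<in> borel_measurable (Rd d)" by measurable
    show ?thesis unfolding ft_def distrib_right
      by (subst Bochner_Integration.integral_add) (auto intro!: integrable_mult_phase assms ph simp: distrib_left)
  qed
  then have "L1norm d (ft d (\<lambda>X. g X + h X)) \<le> (\<integral>\<^sup>+t. ennreal (cmod (ft d g t)) + ennreal (cmod (ft d h t)) \<partial>Rd d)"
    unfolding L1norm_def
    by (intro nn_integral_mono) (auto simp: norm_triangle_ineq simp flip: ennreal_plus intro!: ennreal_leI)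
  also have "\<dots> = L1norm d (ft d g) + L1norm d (ft d h)"
    unfolding L1norm_def by (intro nn_integral_add) (auto intro!: measurable_compose[OF measurable_ft])
  finally show ?thesis .
qed

text \<open>Restricted to indices below d because the points of the product measure are extensional
  functions.\<close>

definition shift :: "nat \<Rightarrow> (nat \<Rightarrow> real) \<Rightarrow> (nat \<Rightarrow> real) \<Rightarrow> nat \<Rightarrow> real" where
  "shift d v t = (\<lambda>i\<in>{..<d}. t i - v i)"

lemma measurable_shift [measurable]: "shift d v \<in> Rd d \<rightarrow>\<^sub>M Rd d"
  unfolding shift_def[abs_def] Rd_def
  by (rule measurable_restrict) measurable

text \<open>A product measure is determined by its values on boxes, and on each side of a box the
  translation invariance of \<open>lborel\<close> applies.\<close>

lemma distr_shift: "distr (Rd d) (Rd d) (shift d v) = Rd d"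
proof -
  have "distr (Rd d) (Rd d) (shift d v) = PiM {..<d} (\<lambda>_. lborel :: real measure)"
  proof (rule lborel_prod.PiM_eqI)
    fix A :: "nat \<Rightarrow> real set" assume A: "\<And>i. i \<in> {..<d} \<Longrightarrow> A i \<in> sets lborel"
    have "shift d v -` (Pi\<^sub>E {..<d} A) \<inter> space (Rd d) = Pi\<^sub>E {..<d} (\<lambda>i. (\<lambda>x. - v i + x) -` A i)"
      by (auto simp: shift_def Rd_def space_PiM PiE_iff extensional_def)
    moreover have "Pi\<^sub>E {..<d} A \<in> sets (Rd d)"
      unfolding Rd_def using A by (intro sets_PiM_I_finite) auto
    ultimately have "emeasure (distr (Rd d) (Rd d) (shift d v)) (Pi\<^sub>E {..<d} A) = emeasure (Rd d) (Pi\<^sub>E {..<d} (\<lambda>i. (\<lambda>x. - v i + x) -` A i))"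
      by (simp add: emeasure_distr)
    also have "\<dots> = (\<Prod>i<d. emeasure lborel ((\<lambda>x. - v i + x) -` A i))"
      unfolding Rd_def
    proof (rule lborel_prod.emeasure_PiM)
      fix i assume "i \<in> {..<d}"
      then show "(\<lambda>x. - v i + x) -` A i \<in> sets lborel"
        using A measurable_sets[of "\<lambda>x. - v i + x" lborel borel "A i"] by simp
    qed simp
    also have "\<dots> = (\<Prod>i<d. emeasure lborel (A i))"
    proof (intro prod.cong refl)
      fix i assume "i \<in> {..<d}"
      then have "A i \<in> sets borel" using A by simp
      then have "emeasure (distr lborel borel (\<lambda>x. - v i + x)) (A i) = emeasure lborel ((\<lambda>x. - v i + x) -` A i)"
        by (simp add: emeasure_distr)
      then show "emeasure lborel ((\<lambda>x. - v i + x) -` A i) = emeasure lborel (A i)"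
        by (simp only: lborel_distr_plus)
    qed
    finally show "emeasure (distr (Rd d) (Rd d) (shift d v)) (Pi\<^sub>E {..<d} A) = (\<Prod>i<d. emeasure lborel (A i))" .
  qed (simp_all add: Rd_def)
  then show ?thesis by (simp add: Rd_def)
qed

lemma L1norm_shift:
  assumes [measurable]: "h \<in> borel_measurable (Rd d)"
  shows "L1norm d (\<lambda>t. h (shift d v t)) = L1norm d h"
proof -
  have "L1norm d h = (\<integral>\<^sup>+t. ennreal (cmod (h t)) \<partial>distr (Rd d) (Rd d) (shift d v))"
    unfolding distr_shift L1norm_def ..
  also have "\<dots> = L1norm d (\<lambda>t. h (shift d v t))"
    unfolding L1norm_def by (subst nn_integral_distr) auto
  finally show ?thesis ..
qed

text \<open>Multiplication by a phase translates the transform by v, which leaves the L1 norm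
  alone.\<close>

lemma L1norm_ft_phase:
  assumes "g \<in> borel_measurable (Rd d)"
  shows "L1norm d (ft d (\<lambda>X. g X * exp (\<i> * complex_of_real (dotp d v X)))) = L1norm d (ft d g)"
proof -
  have "ft d (\<lambda>X. g X * exp (\<i> * complex_of_real (dotp d v X))) = (\<lambda>t. ft d g (shift d v t))"
  proof
    fix t
    have "dotp d (shift d v t) X = dotp d t X - dotp d v X" for X
      by (simp add: dotp_def shift_def left_diff_distrib sum_subtractf)
    then show "ft d (\<lambda>X. g X * exp (\<i> * complex_of_real (dotp d v X))) t = ft d g (shift d v t)"
      unfolding ft_def by (simp add: mult.assoc right_diff_distrib flip: exp_add)
  qed
  then show ?thesis using L1norm_shift[OF measurable_ft[OF assms]] by simp
qed

text \<open>The factor is the characteristic function of a standard normal w at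
  \<open>dotp d v X\<close>, that is, an average of phases along multiples of v, and phases preserve
  the norm.\<close>

lemma L1norm_ft_gaussian_smoothing:
  assumes g: "integrable (Rd d) g"
  shows "L1norm d (ft d (\<lambda>X. g X * complex_of_real (exp (- (dotp d v X)\<^sup>2 / 2)))) \<le> L1norm d (ft d g)"
proof -
  interpret N: real_distribution std_normal_distribution by (rule real_dist_normal_dist)
  have [measurable]: "g \<in> borel_measurable (Rd d)" using g by auto
  let ?h = "\<lambda>w X. g X * exp (\<i> * complex_of_real (dotp d (\<lambda>i. w * v i) X))"
  have dp: "dotp d (\<lambda>i. w * v i) X = w * dotp d v X" for w X
    by (simp add: dotp_def sum_distrib_left mult_ac)
  have "(\<integral>w. ?h w X \<partial>std_normal_distribution) = g X * complex_of_real (exp (- (dotp d v X)\<^sup>2 / 2))" (is "?L X = ?R X") for X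
    using fun_cong[OF char_std_normal_distribution, of "dotp d v X"]
    by (simp add: dp char_def mult.commute)
  then have "L1norm d (ft d (\<lambda>X. g X * complex_of_real (exp (- (dotp d v X)\<^sup>2 / 2))))
      = L1norm d (ft d (\<lambda>X. \<integral>w. ?h w X \<partial>std_normal_distribution))"
    by (simp only:)
  also have "\<dots> \<le> (\<integral>\<^sup>+w. L1norm d (ft d (?h w)) \<partial>std_normal_distribution)"
  proof (rule ft_mixture)
    show "integrable (std_normal_distribution \<Otimes>\<^sub>M Rd d) (\<lambda>(w, X). ?h w X)"
      by (rule integrable_pair_dominated[where G = "\<lambda>X. cmod (g X)"])
         (use g N.finite_measure_axioms in \<open>auto simp: dp norm_mult\<close>)
  qed (rule N.sigma_finite_measure_axioms)
  also have "\<dots> = (\<integral>\<^sup>+w. L1norm d (ft d g) \<partial>std_normal_distribution)"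
    by (intro nn_integral_cong L1norm_ft_phase) measurable
  also have "\<dots> = L1norm d (ft d g)" using N.emeasure_space_1 by simp
  finally show ?thesis .
qed

lemma integrable_mult_bounded:
  assumes "integrable M g" "\<phi> \<in> borel_measurable M" "\<And>x. \<bar>\<phi> x\<bar> \<le> 1"
  shows "integrable M (\<lambda>x. g x * complex_of_real (\<phi> x))"
proof -
  have [measurable]: "g \<in> borel_measurable M" "\<phi> \<in> borel_measurable M" using assms by auto
  show ?thesis
    by (rule Bochner_Integration.integrable_bound[OF assms(1)])
       (auto simp: norm_mult intro!: mult_left_le assms(3))
qed

lemma L1norm_ft_squares_smoothing:
  fixes N :: nat
  assumes g: "integrable (Rd d) g"
  shows "L1norm d (ft d (\<lambda>X. g X * complex_of_real (exp (- (\<Sum>n<N. (dotp d (v n) X)\<^sup>2) / 2)))) \<le> L1norm d (ft d g)"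
proof (induction N)
  case (Suc N)
  let ?g = "\<lambda>X. g X * complex_of_real (exp (- (\<Sum>n<N. (dotp d (v n) X)\<^sup>2) / 2))"
  have "integrable (Rd d) ?g"
    by (rule integrable_mult_bounded[OF g]) (auto intro!: sum_nonneg)
  from L1norm_ft_gaussian_smoothing[OF this, of "v N"]
  have "L1norm d (ft d (\<lambda>X. ?g X * complex_of_real (exp (- (dotp d (v N) X)\<^sup>2 / 2)))) \<le> L1norm d (ft d ?g)" .
  also have "(\<lambda>X. ?g X * complex_of_real (exp (- (dotp d (v N) X)\<^sup>2 / 2))) =
     (\<lambda>X. g X * complex_of_real (exp (- (\<Sum>n<Suc N. (dotp d (v n) X)\<^sup>2) / 2)))"
    by (simp add: fun_eq_iff mult.assoc diff_divide_distrib flip: of_real_mult exp_add)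
  finally show ?case using Suc by simp
qed simp

section \<open>Semidefinite forms as sums of squares\<close>

lemma quadf_Suc:
  assumes "\<And>i l. i < Suc d \<Longrightarrow> l < Suc d \<Longrightarrow> S i l = S l i"
  shows "quadf (Suc d) S X = quadf d S X + 2 * X d * (\<Sum>i<d. S i d * X i) + S d d * (X d)\<^sup>2"
proof -
  have "(\<Sum>l<d. X d * S d l * X l) = X d * (\<Sum>i<d. S i d * X i)" "(\<Sum>i<d. X i * S i d * X d) = X d * (\<Sum>i<d. S i d * X i)"
    using assms by (auto simp: sum_distrib_left intro!: sum.cong)
  then show ?thesis
    by (simp add: quadf_def sum.distrib power2_eq_square)
qed

text \<open>Lagrange's reduction: split off the square completed in the last variable.\<close>
lemma psd_sum_of_squares:
  assumes "\<And>i l. i < d \<Longrightarrow> l < d \<Longrightarrow> S i l = S l i" "\<And>X. 0 \<le> quadf d S X"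
  shows "\<exists>v. \<forall>X. quadf d S X = (\<Sum>n<d. (dotp d (v n) X)\<^sup>2)"
  using assms
proof (induction d arbitrary: S)
  case 0
  then show ?case by (simp add: quadf_def)
next
  case (Suc d)
  have qs: "quadf (Suc d) S X = quadf d S X + 2 * X d * (\<Sum>i<d. S i d * X i) + S d d * (X d)\<^sup>2" for X
    by (rule quadf_Suc) (rule Suc.prems(1))
  have cong: "quadf d A X = quadf d A Y" if "\<And>i. i < d \<Longrightarrow> X i = Y i" for A X Y
    unfolding quadf_def using that by (intro sum.cong) auto
  show ?case
  proof (cases "S d d = 0")
    case True
    have z: "S i d = 0" if i: "i < d" for i
    proof (rule ccontr)
      assume nz: "S i d \<noteq> 0"
      \<comment> \<open>The last coordinate solves S i i + 2 x S i d = -1, so a nonzero off-diagonal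
        entry would make the form negative.\<close>
      let ?X = "\<lambda>n. if n = i then 1 else if n = d then - (S i i + 1) / (2 * S i d) else 0 :: real"
      have "quadf d S ?X = S i i"
        using i by (simp add: quadf_def if_distrib[where f = "\<lambda>c. c * _"] if_distrib[where f = "\<lambda>c. _ * c"] sum.If_cases cong: if_cong)
      moreover have "(\<Sum>n<d. S n d * ?X n) = S i d"
        using i by (subst sum.cong[where h = "\<lambda>n. if n = i then S i d else 0"]) auto
      moreover have "quadf (Suc d) S ?X = quadf d S ?X + 2 * ?X d * (\<Sum>n<d. S n d * ?X n) + S d d * (?X d)\<^sup>2"
        by (rule qs)
      moreover have "?X d = - (S i i + 1) / (2 * S i d)" using i by simp
      ultimately have "quadf (Suc d) S ?X = S i i + 2 * (- (S i i + 1) / (2 * S i d)) * S i d"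
        unfolding True by (simp only: mult_zero_left add_0_right)
      also have "\<dots> = - 1" using nz by (simp add: field_simps)
      finally show False using Suc.prems(2)[of ?X] by simp
    qed
    have eq: "quadf (Suc d) S X = quadf d S X" for X
      unfolding qs using True z by simp
    from Suc.IH[of S] Suc.prems obtain v where v: "\<And>X. quadf d S X = (\<Sum>n<d. (dotp d (v n) X)\<^sup>2)"
      by (auto simp: eq)
    \<comment> \<open>The squares of dimension d are padded by a zero vector at index d, since
      exactly \<open>Suc d\<close> of them are asked for.\<close>
    show ?thesis
      by (rule exI[where x = "\<lambda>n i. if n < d \<and> i < d then v n i else 0"])
         (simp add: eq v dotp_def)
  next
    case False
    let ?u = "\<lambda>n. if n = d then 1 else 0 :: real"
    have "quadf (Suc d) S ?u = S d d" unfolding qs by (simp add: quadf_def)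
    then have pos: "S d d > 0" using Suc.prems(2)[of ?u] False by simp
    \<comment> \<open>The Schur complement of the last diagonal entry.\<close>
    define S' where "S' i l = S i l - S i d * S l d / S d d" for i l
    have sq: "quadf d S' X = quadf d S X - (\<Sum>i<d. S i d * X i)\<^sup>2 / S d d" for X
      by (simp add: S'_def quadf_def power2_eq_square sum_product sum_subtractf[symmetric] sum_divide_distrib algebra_simps)
    have eq: "quadf (Suc d) S X = quadf d S' X + ((\<Sum>i<d. S i d * X i) / sqrt (S d d) + sqrt (S d d) * X d)\<^sup>2" for X
      unfolding qs sq using pos by (simp add: power2_sum power_divide power_mult_distrib field_simps) (simp add: power2_eq_square)
    have "0 \<le> quadf d S' X" for X
    proof -
      \<comment> \<open>The last coordinate is chosen to make the completed square vanish, so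
        positivity passes to S'.\<close>
      let ?Y = "X(d := - (\<Sum>i<d. S i d * X i) / S d d)"
      have "(\<Sum>i<d. S i d * ?Y i) = (\<Sum>i<d. S i d * X i)" by (intro sum.cong) auto
      then have "quadf (Suc d) S ?Y = quadf d S' X"
        unfolding eq using pos cong[of ?Y X S'] by (simp add: field_simps flip: real_sqrt_mult)
      then show ?thesis using Suc.prems(2)[of ?Y] by (simp only:)
    qed
    moreover have "S' i l = S' l i" if "i < d" "l < d" for i l
      using Suc.prems(1)[of i l] that by (simp add: S'_def)
    ultimately obtain v where v: "\<And>X. quadf d S' X = (\<Sum>n<d. (dotp d (v n) X)\<^sup>2)"
      using Suc.IH[of S'] by auto
    let ?v = "\<lambda>n i. if n < d then (if i < d then v n i else 0) else if i < d then S i d / sqrt (S d d) else sqrt (S d d)"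
    show ?thesis
    proof (rule exI[where x = ?v], intro allI)
      fix X
      have "(\<Sum>i<d. S i d * X i) / sqrt (S d d) + sqrt (S d d) * X d = dotp (Suc d) (?v d) X"
        by (simp add: dotp_def sum_divide_distrib)
      moreover have "dotp (Suc d) (?v n) X = dotp d (v n) X" if "n < d" for n
        using that by (simp add: dotp_def)
      ultimately show "quadf (Suc d) S X = (\<Sum>n<Suc d. (dotp (Suc d) (?v n) X)\<^sup>2)"
        unfolding eq v by simp
    qed
  qed
qed

lemma L1norm_ft_trep_gaussian:
  assumes p: "trep d r p B" and b: "0 < b"
    and sym: "\<And>i l. i < d \<Longrightarrow> l < d \<Longrightarrow> S i l = S l i"
    and psd: "\<And>X. b * sqnorm d X \<le> sqnorm d X + quadf d S X"
  shows "L1norm d (ft d (\<lambda>X. complex_of_real (p X) *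
      exp (\<i> * complex_of_real (dotp d \<nu> X) - complex_of_real ((sqnorm d X + quadf d S X) / 2))))
    \<le> ennreal (real r ^ r / sqrt b ^ r * B)"
proof -
  obtain T where T: "p = tens d r T" "L2_set T (tidx d r) \<le> B" using p by (rule trepE)
  \<comment> \<open>The form of S' is that of I + S minus b I, semidefinite by \<open>psd\<close>.
    Smoothing removes its squares one by one and leaves the isotropic Gaussian of precision
    b.\<close>
  define S' where "S' i l = S i l + (if i = l then 1 - b else 0)" for i l
  have "quadf d S' X = quadf d S X + (1 - b) * sqnorm d X" for X
  proof -
    have "X i * S' i l * X l = X i * S i l * X l + (if l = i then (1 - b) * (X i)\<^sup>2 else 0)" for i l
      by (auto simp: S'_def power2_eq_square algebra_simps)
    then show ?thesis by (simp add: quadf_def sqnorm_def sum.distrib sum_distrib_left)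
  qed
  then have S': "quadf d S' X = sqnorm d X + quadf d S X - b * sqnorm d X" for X
    by (simp add: algebra_simps)
  obtain v where v: "\<And>X. quadf d S' X = (\<Sum>n<d. (dotp d (v n) X)\<^sup>2)"
  proof -
    have "\<exists>v. \<forall>X. quadf d S' X = (\<Sum>n<d. (dotp d (v n) X)\<^sup>2)"
      by (rule psd_sum_of_squares) (use sym psd in \<open>auto simp: S' S'_def\<close>)
    then show thesis using that by blast
  qed
  let ?g = "\<lambda>X. complex_of_real (p X * gw d b X)"
  have g: "integrable (Rd d) ?g"
    unfolding T by (intro integrable_of_real integrable_tens_gaussian b)
  have eq: "(\<lambda>X. complex_of_real (p X) *
      exp (\<i> * complex_of_real (dotp d \<nu> X) - complex_of_real ((sqnorm d X + quadf d S X) / 2)))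
    = (\<lambda>X. (?g X * complex_of_real (exp (- (\<Sum>n<d. (dotp d (v n) X)\<^sup>2) / 2))) * exp (\<i> * complex_of_real (dotp d \<nu> X)))"
  proof
    fix X
    have "- (b/2) * sqnorm d X + - (\<Sum>n<d. (dotp d (v n) X)\<^sup>2) / 2 = - ((sqnorm d X + quadf d S X) / 2)"
      using S'[of X] v[of X] by (simp add: field_simps)
    then have "gw d b X * exp (- (\<Sum>n<d. (dotp d (v n) X)\<^sup>2) / 2) = exp (- ((sqnorm d X + quadf d S X) / 2))"
      unfolding gw_def by (simp flip: exp_add)
    then have "complex_of_real (gw d b X) * complex_of_real (exp (- (\<Sum>n<d. (dotp d (v n) X)\<^sup>2) / 2)) = exp (- complex_of_real ((sqnorm d X + quadf d S X) / 2))"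
      by (simp only: of_real_mult[symmetric] of_real_minus[symmetric] exp_of_real)
    then show "complex_of_real (p X) *
      exp (\<i> * complex_of_real (dotp d \<nu> X) - complex_of_real ((sqnorm d X + quadf d S X) / 2)) =
      (?g X * complex_of_real (exp (- (\<Sum>n<d. (dotp d (v n) X)\<^sup>2) / 2))) * exp (\<i> * complex_of_real (dotp d \<nu> X))"
      unfolding diff_conv_add_uminus exp_add by (simp only: of_real_mult mult_ac)
  qed
  have [measurable]: "?g \<in> borel_measurable (Rd d)" using g by auto
  have "L1norm d (ft d (\<lambda>X. complex_of_real (p X) *
      exp (\<i> * complex_of_real (dotp d \<nu> X) - complex_of_real ((sqnorm d X + quadf d S X) / 2))))
    = L1norm d (ft d (\<lambda>X. ?g X * complex_of_real (exp (- (\<Sum>n<d. (dotp d (v n) X)\<^sup>2) / 2))))"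
    unfolding eq by (rule L1norm_ft_phase) measurable
  also have "\<dots> \<le> L1norm d (ft d ?g)"
    by (rule L1norm_ft_squares_smoothing[OF g])
  also have "\<dots> \<le> ennreal (real r ^ r / sqrt b ^ r * L2_set T (tidx d r))"
    unfolding T by (rule L1norm_ft_tens_gaussian[OF b])
  also have "\<dots> \<le> ennreal (real r ^ r / sqrt b ^ r * B)"
    using T(2) b by (intro ennreal_leI mult_left_mono) auto
  finally show ?thesis .
qed

subsection \<open>Polynomial-exponential functions and the annihilating operators\<close>

text \<open>Coefficients stay real so that they can be forms with real tensors; only the evaluation
  point is complex.\<close>

definition cpoly :: "real poly \<Rightarrow> complex \<Rightarrow> complex" where
  "cpoly p = poly (map_poly complex_of_real p)"

lemma cpoly_0 [simp]: "cpoly 0 z = 0"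
  by (simp add: cpoly_def)

lemma cpoly_pCons [simp]: "cpoly (pCons a p) z = of_real a + z * cpoly p z"
  by (simp add: cpoly_def map_poly_pCons)

lemma cpoly_add [simp]: "cpoly (p + q) z = cpoly p z + cpoly q z"
  by (induction p q rule: poly_induct2) (simp_all add: algebra_simps)

lemma cpoly_smult [simp]: "cpoly (smult c p) z = of_real c * cpoly p z"
  by (induction p) (simp_all add: algebra_simps)

lemma cpoly_mult [simp]: "cpoly (p * q) z = cpoly p z * cpoly q z"
  by (induction p) (simp_all add: algebra_simps)

lemma cpoly_sum: "cpoly (\<Sum>i\<in>A. p i) z = (\<Sum>i\<in>A. cpoly (p i) z)"
  by (induction A rule: infinite_finite_induct) simp_all

lemma cpoly_monom: "cpoly (monom c n) z = of_real c * z ^ n"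
  by (induction n) (simp_all add: monom_0 monom_Suc)

lemma cpoly_pderiv: "(cpoly p has_field_derivative cpoly (pderiv p) z) (at z)"
proof -
  have "map_poly complex_of_real (pderiv p) = pderiv (map_poly complex_of_real p)"
    by (rule poly_eqI) (simp add: coeff_map_poly coeff_pderiv)
  then show ?thesis using poly_DERIV[of "map_poly complex_of_real p" z] by (simp add: cpoly_def[abs_def])
qed

text \<open>The degree of a coefficient family varies with X; a common length N makes the expansion
  uniform in X.\<close>

lemma cpoly_altdef:
  assumes "\<And>e. N \<le> e \<Longrightarrow> coeff p e = 0"
  shows "cpoly p z = (\<Sum>e<N. of_real (coeff p e) * z ^ e)"
proof -
  have "p = (\<Sum>e<N. monom (coeff p e) e)"
    by (rule poly_eqI) (use assms in \<open>auto simp: coeff_sum not_less\<close>)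
  then have "cpoly p z = cpoly (\<Sum>e<N. monom (coeff p e) e) z" by simp
  then show ?thesis by (simp add: cpoly_sum cpoly_monom)
qed

text \<open>A family Q of polynomials encodes the function
  \<open>\<Sum>j. Q j y * exp (m j * y + s j * y\<^sup>2 / 2)\<close> of y; \<open>step m s l\<close> encodes the action of the
  differential operator d/dy - (m l + s l * y) on it, which lowers the degree of \<open>Q l\<close>
  and raises the other degrees by at most one.\<close>
definition step :: "(nat \<Rightarrow> real) \<Rightarrow> (nat \<Rightarrow> real) \<Rightarrow> nat \<Rightarrow> (nat \<Rightarrow> real poly) \<Rightarrow> nat \<Rightarrow> real poly" where
  "step m s l Q j = pderiv (Q j) + [:m j - m l, s j - s l:] * Q j"

fun chain :: "(nat \<Rightarrow> real) \<Rightarrow> (nat \<Rightarrow> real) \<Rightarrow> nat list \<Rightarrow> (nat \<Rightarrow> real poly) \<Rightarrow> nat \<Rightarrow> real poly" where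
  "chain m s [] Q = Q"
| "chain m s (l # ls) Q = chain m s ls (step m s l Q)"

lemma chain_append: "chain m s (ls @ ls') Q = chain m s ls' (chain m s ls Q)"
  by (induction ls arbitrary: Q) simp_all

lemma coeff_linear_mult:
  "coeff ([:a, b:] * p) e = a * coeff p e + (if e = 0 then 0 else b * coeff p (e - 1))"
  by (cases e) simp_all

lemma coeff_step:
  "coeff (step m s l Q j) e = real (Suc e) * coeff (Q j) (Suc e) + (m j - m l) * coeff (Q j) e
    + (if e = 0 then 0 else (s j - s l) * coeff (Q j) (e - 1))"
  by (simp only: step_def coeff_add coeff_pderiv coeff_linear_mult add.assoc)

lemma chain_coeff_0:
  assumes "\<And>e. n \<le> e \<Longrightarrow> coeff (Q j) e = 0"
  shows "n + length ls \<le> e \<Longrightarrow> coeff (chain m s ls Q j) e = 0"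
  using assms
proof (induction ls arbitrary: Q n)
  case (Cons l ls)
  show ?case unfolding chain.simps
    by (rule Cons.IH[of "Suc n"]) (use Cons.prems in \<open>auto simp: coeff_step\<close>)
qed simp

lemma chain_zero: "Q j = 0 \<Longrightarrow> chain m s ls Q j = 0"
proof (induction ls arbitrary: Q)
  case (Cons l ls)
  show ?case unfolding chain.simps by (rule Cons.IH) (simp add: step_def Cons.prems)
qed simp

text \<open>For l = j the linear factor in \<open>step\<close> is 0, so only differentiation is
  left, and n derivatives kill n coefficients.\<close>

lemma chain_replicate_zero:
  assumes "\<And>e. n \<le> e \<Longrightarrow> coeff (Q j) e = 0"
  shows "chain m s (replicate n j) Q j = 0"
  using assms
proof (induction n arbitrary: Q)
  case 0
  then show ?case by (simp add: poly_eq_iff)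
next
  case (Suc n)
  show ?case unfolding replicate_Suc chain.simps
    by (rule Suc.IH) (use Suc.prems in \<open>auto simp: coeff_step\<close>)
qed

text \<open>The list precedes m, s and Q in the quantifiers: one list must work for every point X,
  every dimension and all parameters.\<close>

lemma annihilating_chain_exists:
  "\<exists>ls. set ls \<subseteq> {..<k} \<and> (\<forall>m s Q. (\<forall>j<k. \<forall>e\<ge>n. coeff (Q j) e = 0) \<longrightarrow> (\<forall>j<k. chain m s ls Q j = 0))"
proof (induction k)
  case 0
  show ?case by (intro exI[of _ "[]"]) simp
next
  case (Suc k)
  then obtain ls where ls: "set ls \<subseteq> {..<k}"
    "\<And>m s Q. (\<forall>j<k. \<forall>e\<ge>n. coeff (Q j) e = 0) \<Longrightarrow> (\<forall>j<k. chain m s ls Q j = 0)" by blast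
  show ?case
  \<comment> \<open>The operators in ls may have raised the degree of the new polynomial by
    \<open>length ls\<close>, hence the number of repetitions.\<close>
  proof (intro exI[of _ "ls @ replicate (n + length ls) k"] conjI allI impI)
    show "set (ls @ replicate (n + length ls) k) \<subseteq> {..<Suc k}" using ls(1) by auto
    fix m s :: "nat \<Rightarrow> real" and Q :: "nat \<Rightarrow> real poly" and j assume Q: "\<forall>j<Suc k. \<forall>e\<ge>n. coeff (Q j) e = 0" and j: "j < Suc k"
    show "chain m s (ls @ replicate (n + length ls) k) Q j = 0"
    proof (cases "j = k")
      case True
      have "coeff (chain m s ls Q k) e = 0" if "n + length ls \<le> e" for e
        by (rule chain_coeff_0[OF _ that]) (use Q in auto)
      then show ?thesis unfolding True chain_append by (rule chain_replicate_zero)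
    next
      case False
      then have "chain m s ls Q j = 0" using ls(2)[of Q m s] Q j by auto
      then show ?thesis unfolding chain_append by (rule chain_zero)
    qed
  qed
qed

text \<open>Differentiation carried to the polynomial factor: the derivative of q y exp(m y + s y^2
  / 2) is \<open>dpoly m s q\<close> times the same exponential.\<close>

definition dpoly :: "real \<Rightarrow> real \<Rightarrow> real poly \<Rightarrow> real poly" where
  "dpoly m s q = pderiv q + [:m, s:] * q"

lemma dpoly_diff: "dpoly m s (p - q) = dpoly m s p - dpoly m s q"
  by (simp add: dpoly_def pderiv_diff algebra_simps smult_diff_right)

lemma dpoly_funpow_diff: "(dpoly m s ^^ n) (p - q) = (dpoly m s ^^ n) p - (dpoly m s ^^ n) q"
  by (induction n) (simp_all add: dpoly_diff)

lemma dpoly_linear_mult: "dpoly m s ([:a, b:] * q) = [:a, b:] * dpoly m s q + smult b q"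
proof -
  have "pderiv ([:a, b:] * q) = [:a, b:] * pderiv q + smult b q"
    by (simp only: pderiv_mult) (simp add: pderiv_pCons)
  then show ?thesis
    by (simp add: dpoly_def algebra_simps smult_add_right)
qed

lemma dpoly_add: "dpoly m s (p + q) = dpoly m s p + dpoly m s q"
  by (simp add: dpoly_def pderiv_add algebra_simps smult_add_right)

lemma dpoly_smult: "dpoly m s (smult c q) = smult c (dpoly m s q)"
  by (simp add: dpoly_def pderiv_smult smult_add_right)

text \<open>The Leibniz rule for a factor whose second derivative is 0. At n = 0 the truncated n - 1
  carries the coefficient 0.\<close>

lemma dpoly_funpow_linear_mult:
  "(dpoly m s ^^ n) ([:a, b:] * q) = [:a, b:] * (dpoly m s ^^ n) q + smult (real n * b) ((dpoly m s ^^ (n - 1)) q)"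
proof (induction n)
  case (Suc n)
  have "dpoly m s (smult (real n * b) ((dpoly m s ^^ (n - 1)) q)) = smult (real n * b) ((dpoly m s ^^ n) q)"
    by (cases n) (simp_all add: dpoly_smult, simp add: dpoly_def)
  then show ?case
    by (simp add: Suc dpoly_add dpoly_linear_mult add.assoc smult_add_left[symmetric] distrib_right del: mult_pCons_left)
qed simp

text \<open>The n-th derivative at 0 of the encoded function, so on the original family it is the
  n-th primary term.\<close>

definition taylor :: "nat \<Rightarrow> (nat \<Rightarrow> real) \<Rightarrow> (nat \<Rightarrow> real) \<Rightarrow> (nat \<Rightarrow> real poly) \<Rightarrow> nat \<Rightarrow> real" where
  "taylor k m s Q n = (\<Sum>j<k. coeff ((dpoly (m j) (s j) ^^ n) (Q j)) 0)"

text \<open>The n-th derivative at 0 of F' - (m l + s l y) F. The coefficients of the polynomials do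
  not enter, which is why bounds on the primary terms propagate along the chain.\<close>

lemma taylor_step:
  "taylor k m s (step m s l Q) n =
    taylor k m s Q (Suc n) - m l * taylor k m s Q n - real n * s l * taylor k m s Q (n - 1)"
proof -
  have "step m s l Q j = dpoly (m j) (s j) (Q j) - [:m l, s l:] * Q j" for j
    by (simp add: step_def dpoly_def algebra_simps smult_diff_left)
  then have "(dpoly (m j) (s j) ^^ n) (step m s l Q j) =
     (dpoly (m j) (s j) ^^ Suc n) (Q j) - ([:m l, s l:] * (dpoly (m j) (s j) ^^ n) (Q j)
       + smult (real n * s l) ((dpoly (m j) (s j) ^^ (n - 1)) (Q j)))" for j
    by (simp only: dpoly_funpow_diff dpoly_funpow_linear_mult funpow_Suc_right o_apply)
  then have "coeff ((dpoly (m j) (s j) ^^ n) (step m s l Q j)) 0 =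
     coeff ((dpoly (m j) (s j) ^^ Suc n) (Q j)) 0 - m l * coeff ((dpoly (m j) (s j) ^^ n) (Q j)) 0
     - real n * s l * coeff ((dpoly (m j) (s j) ^^ (n - 1)) (Q j)) 0" for j
    by (simp only: coeff_diff coeff_add coeff_linear_mult coeff_smult) simp
  then show ?thesis
    by (simp add: taylor_def sum_subtractf sum_distrib_left del: funpow.simps)
qed

lemma deriv_funpow_exp_poly:
  "(deriv ^^ n) (\<lambda>y. \<Sum>j<k. poly (Q j) y * exp (m j * y + 1/2 * s j * y\<^sup>2)) =
    (\<lambda>y. \<Sum>j<k. poly ((dpoly (m j) (s j) ^^ n) (Q j)) y * exp (m j * y + 1/2 * s j * y\<^sup>2))"
proof (induction n)
  case (Suc n)
  have "((\<lambda>y. \<Sum>j<k. poly ((dpoly (m j) (s j) ^^ n) (Q j)) y * exp (m j * y + 1/2 * s j * y\<^sup>2))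
     has_real_derivative (\<Sum>j<k. poly ((dpoly (m j) (s j) ^^ Suc n) (Q j)) y * exp (m j * y + 1/2 * s j * y\<^sup>2))) (at y)" for y
    by (auto intro!: derivative_eq_intros sum.cong simp: dpoly_def algebra_simps)
  then have "deriv (\<lambda>y. \<Sum>j<k. poly ((dpoly (m j) (s j) ^^ n) (Q j)) y * exp (m j * y + 1/2 * s j * y\<^sup>2))
     = (\<lambda>y. \<Sum>j<k. poly ((dpoly (m j) (s j) ^^ Suc n) (Q j)) y * exp (m j * y + 1/2 * s j * y\<^sup>2))"
    by (intro ext DERIV_imp_deriv)
  then show ?case by (simp only: funpow.simps(2)[of n deriv] o_apply Suc)
qed simp

text \<open>The encoded function at y = \<i> \<tau>; squaring y flips the sign of the quadratic
  exponent.\<close>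

definition val :: "nat \<Rightarrow> (nat \<Rightarrow> real) \<Rightarrow> (nat \<Rightarrow> real) \<Rightarrow> (nat \<Rightarrow> real poly) \<Rightarrow> real \<Rightarrow> complex" where
  "val k m s Q \<tau> = (\<Sum>j<k. cpoly (Q j) (\<i> * of_real \<tau>) *
     exp (\<i> * of_real (m j * \<tau>) - of_real (s j * \<tau>\<^sup>2 / 2)))"

definition expval :: "real \<Rightarrow> real \<Rightarrow> real \<Rightarrow> complex" where
  "expval m s \<tau> = exp (\<i> * of_real (m * \<tau>) - of_real (s * \<tau>\<^sup>2 / 2))"

text \<open>Variation of constants for the operator encoded by \<open>step m s l\<close>, along the imaginary axis.\<close>
lemma val_variation_of_constants:
  assumes \<tau>: "0 \<le> \<tau>"
  shows "val k m s Q \<tau> = expval (m l) (s l) \<tau> *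
    (of_real (taylor k m s Q 0) +
     (\<integral>t. indicator {0..\<tau>} t *\<^sub>R (\<i> * (val k m s (step m s l Q) t * expval (- m l) (- s l) t)) \<partial>lborel))"
proof -
  have ex: "expval a b t * expval a' b' t = expval (a + a') (b + b') t" for a b a' b' t
    by (simp add: expval_def algebra_simps add_divide_distrib flip: exp_add)
  \<comment> \<open>Dividing by the exponential of index l turns the first order operator into plain
    differentiation; the factor \<i> in the derivative of W is dy/dt.\<close>
  define W where "W Q t = (\<Sum>j<k. cpoly (Q j) (\<i> * of_real t) * expval (m j - m l) (s j - s l) t)" for Q :: "nat \<Rightarrow> real poly" and t
  have W: "val k m s Q t * expval (- m l) (- s l) t = W Q t" for Q t
    unfolding val_def W_def expval_def[symmetric] sum_distrib_right mult.assoc ex by simp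
  have inv: "expval (m l) (s l) t * expval (- m l) (- s l) t = 1" for t
    unfolding ex by (simp add: expval_def)
  have d: "(W Q has_vector_derivative \<i> * W (step m s l Q) t) (at t)" for t
  proof -
    have e: "((\<lambda>z. exp (\<i> * (of_real a * z) - of_real b * z\<^sup>2 / 2)) has_field_derivative
        (\<i> * of_real a - of_real b * of_real t) * exp (\<i> * (of_real a * of_real t) - of_real b * (of_real t)\<^sup>2 / 2)) (at (complex_of_real t))" for a b
      by (auto intro!: derivative_eq_intros simp: algebra_simps)
    have p: "((\<lambda>z. cpoly (Q j) (\<i> * z)) has_field_derivative \<i> * cpoly (pderiv (Q j)) (\<i> * of_real t)) (at (complex_of_real t))" for j
    proof -
      have "((\<lambda>z. \<i> * z) has_field_derivative \<i>) (at (complex_of_real t))"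
        by (auto intro!: derivative_eq_intros)
      from DERIV_chain2[OF cpoly_pderiv this] show ?thesis by (simp only: mult.commute)
    qed
    have "((\<lambda>z. \<Sum>j<k. cpoly (Q j) (\<i> * z) * exp (\<i> * (of_real (m j - m l) * z) - of_real (s j - s l) * z\<^sup>2 / 2)) has_field_derivative
        (\<Sum>j<k. (\<i> * cpoly (pderiv (Q j)) (\<i> * of_real t)) * exp (\<i> * (of_real (m j - m l) * of_real t) - of_real (s j - s l) * (of_real t)\<^sup>2 / 2) +
          ((\<i> * of_real (m j - m l) - of_real (s j - s l) * of_real t) * exp (\<i> * (of_real (m j - m l) * of_real t) - of_real (s j - s l) * (of_real t)\<^sup>2 / 2))
          * cpoly (Q j) (\<i> * of_real t))) (at (complex_of_real t))"
      by (intro DERIV_sum DERIV_mult e p)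
    also have "(\<Sum>j<k. (\<i> * cpoly (pderiv (Q j)) (\<i> * of_real t)) * exp (\<i> * (of_real (m j - m l) * of_real t) - of_real (s j - s l) * (of_real t)\<^sup>2 / 2) +
          ((\<i> * of_real (m j - m l) - of_real (s j - s l) * of_real t) * exp (\<i> * (of_real (m j - m l) * of_real t) - of_real (s j - s l) * (of_real t)\<^sup>2 / 2))
          * cpoly (Q j) (\<i> * of_real t)) = \<i> * W (step m s l Q) t"
      unfolding W_def sum_distrib_left by (intro sum.cong) (simp_all add: step_def expval_def algebra_simps)
    finally show ?thesis
      by (rule has_vector_derivative_real_field[THEN has_vector_derivative_transform_within_open[where S = UNIV], rotated 0])
         (auto simp: W_def expval_def)
  qed
  have c: "continuous_on {0..\<tau>} (\<lambda>t. \<i> * W (step m s l Q) t)"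
    unfolding W_def expval_def cpoly_def by (intro continuous_intros) auto
  have "(\<integral>t. indicator {0..\<tau>} t *\<^sub>R (\<i> * W (step m s l Q) t) \<partial>lborel) = W Q \<tau> - W Q 0"
    by (rule integral_FTC_Icc[OF \<tau>]) (auto intro!: c has_vector_derivative_at_within d)
  moreover have "W Q 0 = of_real (taylor k m s Q 0)"
  proof -
    have "cpoly p 0 = of_real (coeff p 0)" for p
      by (cases p) simp
    then show ?thesis by (simp add: W_def taylor_def expval_def)
  qed
  ultimately have "expval (m l) (s l) \<tau> * (of_real (taylor k m s Q 0) +
     (\<integral>t. indicator {0..\<tau>} t *\<^sub>R (\<i> * (val k m s (step m s l Q) t * expval (- m l) (- s l) t)) \<partial>lborel))
     = expval (m l) (s l) \<tau> * (val k m s Q \<tau> * expval (- m l) (- s l) \<tau>)"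
    by (simp add: W)
  also have "\<dots> = val k m s Q \<tau>" using inv[of \<tau>] by (simp add: mult.commute mult.left_commute)
  finally show ?thesis ..
qed

subsection \<open>Descent along the annihilating chain\<close>

lemma L1norm_ft_mult_i: "L1norm d (ft d (\<lambda>X. \<i> * g X)) = L1norm d (ft d g)"
  unfolding L1norm_def ft_def by (simp add: norm_mult norm_divide mult.assoc)

locale gaussian_family =
  fixes d k :: nat and \<alpha> \<beta> :: real and mu :: "nat \<Rightarrow> nat \<Rightarrow> real" and Sig :: "nat \<Rightarrow> nat \<Rightarrow> nat \<Rightarrow> real"
  assumes k: "0 < k" and reg: "regular_form d k \<alpha> \<beta> mu Sig"
begin

definition M :: "(nat \<Rightarrow> real) \<Rightarrow> nat \<Rightarrow> real" where "M X j = dotp d (mu j) X"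
definition S :: "(nat \<Rightarrow> real) \<Rightarrow> nat \<Rightarrow> real" where "S X j = quadf d (Sig j) X"

lemma \<beta>_pos: "0 < \<beta>" and b_pos: "0 < 1 / \<beta>"
  using reg by (auto simp: regular_form_def)

lemma \<alpha>_nonneg: "0 \<le> \<alpha>"
  using reg k sum_nonneg[of "{..<d}" "\<lambda>i. (mu 0 i)\<^sup>2"]
  by (auto simp: regular_form_def sqnorm_def intro: order_trans[OF real_sqrt_ge_zero])

lemma trep_M: "j < k \<Longrightarrow> trep d 1 (\<lambda>X. M X j) \<alpha>"
  unfolding M_def using reg by (intro trep_mono[OF trep_dotp]) (simp add: regular_form_def)

lemma trep_S: "j < k \<Longrightarrow> trep d 2 (\<lambda>X. S X j) \<alpha>"
  unfolding S_def using reg by (intro trep_mono[OF trep_quadf]) (simp add: regular_form_def)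

lemma convex_combination_bound:
  assumes w: "\<And>j. j < k \<Longrightarrow> 0 \<le> w j" "(\<Sum>j<k. w j) = 1"
  shows "1 / \<beta> * sqnorm d X \<le> sqnorm d X + (\<Sum>j<k. w j * S X j)"
proof -
  have "(\<Sum>j<k. w j * (1 / \<beta> * sqnorm d X)) \<le> (\<Sum>j<k. w j * (sqnorm d X + S X j))"
    using w reg by (intro sum_mono mult_left_mono) (auto simp: regular_form_def S_def)
  moreover have "(\<Sum>j<k. w j * (sqnorm d X + S X j)) = sqnorm d X + (\<Sum>j<k. w j * S X j)"
    using w(2) by (simp add: distrib_left sum.distrib flip: sum_distrib_right)
  moreover have "(\<Sum>j<k. w j * (1 / \<beta> * sqnorm d X)) = 1 / \<beta> * sqnorm d X"
    using w(2) by (simp only: sum_distrib_right[symmetric])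
  ultimately show ?thesis by simp
qed

text \<open>The weight of \<open>chi\<close> together with all phases and Gaussian factors collected
  from the operators already solved.\<close>

definition ker :: "(nat \<Rightarrow> real) \<Rightarrow> (nat \<Rightarrow> real) \<Rightarrow> (nat \<Rightarrow> real) \<Rightarrow> complex" where
  "ker \<nu> w X = exp (\<i> * complex_of_real (dotp d \<nu> X) - complex_of_real ((sqnorm d X + (\<Sum>j<k. w j * S X j)) / 2))"

text \<open>The kernel absorbs the ratio of the exponentials of index l at times \<tau> and t. Index
  l gains the weight \<tau>^2 - t^2, nonnegative when 0 \<le> t \<le> \<tau>.\<close>

lemma ker_expval:
  assumes l: "l < k"
  shows "expval (M X l) (S X l) \<tau> * expval (- M X l) (- S X l) t * ker \<nu> w X =
    ker (\<lambda>i. \<nu> i + (\<tau> - t) * mu l i) (\<lambda>j. w j + (if j = l then \<tau>\<^sup>2 - t\<^sup>2 else 0)) X"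
proof -
  have "(\<Sum>j<k. (w j + (if j = l then \<tau>\<^sup>2 - t\<^sup>2 else 0)) * S X j) = (\<Sum>j<k. w j * S X j + (if j = l then (\<tau>\<^sup>2 - t\<^sup>2) * S X l else 0))"
    by (intro sum.cong) (auto simp: distrib_right)
  also have "\<dots> = (\<Sum>j<k. w j * S X j) + (\<tau>\<^sup>2 - t\<^sup>2) * S X l"
    using l by (simp add: sum.distrib)
  finally have w: "(\<Sum>j<k. (w j + (if j = l then \<tau>\<^sup>2 - t\<^sup>2 else 0)) * S X j) = (\<Sum>j<k. w j * S X j) + (\<tau>\<^sup>2 - t\<^sup>2) * S X l" .
  have \<nu>: "dotp d (\<lambda>i. \<nu> i + (\<tau> - t) * mu l i) X = dotp d \<nu> X + (\<tau> - t) * M X l"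
    by (simp add: dotp_def M_def distrib_right sum.distrib sum_distrib_left mult.assoc)
  show ?thesis
    unfolding ker_def expval_def w \<nu> by (simp add: algebra_simps add_divide_distrib diff_divide_distrib flip: exp_add)
qed

lemma cmod_ker_le:
  assumes w: "\<And>j. j < k \<Longrightarrow> 0 \<le> w j" "(\<Sum>j<k. w j) = 1"
  shows "cmod (ker \<nu> w X) \<le> gw d (1 / \<beta>) X"
  using convex_combination_bound[OF w, of X] by (simp add: ker_def gw_def)

lemma L1norm_hpoly_ker:
  assumes p: "trep d r p B" and w: "\<And>j. j < k \<Longrightarrow> 0 \<le> w j" "(\<Sum>j<k. w j) = 1"
  shows "L1norm d (ft d (\<lambda>X. complex_of_real (p X) * ker \<nu> w X)) \<le> ennreal (real r ^ r * sqrt \<beta> ^ r * B)"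
proof -
  have q: "quadf d (\<lambda>i l. \<Sum>j<k. w j * Sig j i l) X = (\<Sum>j<k. w j * S X j)" for X
  proof -
    have "quadf d (\<lambda>i l. \<Sum>j<k. w j * Sig j i l) X = (\<Sum>i<d. \<Sum>l<d. \<Sum>j<k. w j * (X i * Sig j i l * X l))"
      by (simp add: quadf_def sum_distrib_left sum_distrib_right mult_ac)
    also have "\<dots> = (\<Sum>i<d. \<Sum>j<k. \<Sum>l<d. w j * (X i * Sig j i l * X l))"
      by (intro sum.cong refl sum.swap)
    also have "\<dots> = (\<Sum>j<k. \<Sum>i<d. \<Sum>l<d. w j * (X i * Sig j i l * X l))"
      by (rule sum.swap)
    finally show ?thesis by (simp add: S_def quadf_def sum_distrib_left)
  qed
  have "L1norm d (ft d (\<lambda>X. complex_of_real (p X) * ker \<nu> w X)) \<le> ennreal (real r ^ r / sqrt (1 / \<beta>) ^ r * B)"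
    unfolding ker_def q[symmetric]
  proof (rule L1norm_ft_trep_gaussian[OF p b_pos])
    show "(\<Sum>j<k. w j * Sig j i l) = (\<Sum>j<k. w j * Sig j l i)" if "i < d" "l < d" for i l
      using reg that by (intro sum.cong) (auto simp: regular_form_def)
    show "1 / \<beta> * sqnorm d X \<le> sqnorm d X + quadf d (\<lambda>i l. \<Sum>j<k. w j * Sig j i l) X" for X
      unfolding q by (rule convex_combination_bound[OF w])
  qed
  also have "real r ^ r / sqrt (1 / \<beta>) ^ r = real r ^ r * sqrt \<beta> ^ r"
    by (simp add: real_sqrt_divide power_divide)
  finally show ?thesis .
qed

text \<open>Give X weight 1 and y weight -1: the family then has weight h. Each of d/dy, M and S y
  has weight 1, so a step raises h by one. N bounds the number of coefficients uniformly in
  X.\<close>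

definition homogeneous :: "nat \<Rightarrow> nat \<Rightarrow> ((nat \<Rightarrow> real) \<Rightarrow> nat \<Rightarrow> real poly) \<Rightarrow> bool" where
  "homogeneous h N Q \<longleftrightarrow> (\<forall>j<k. \<forall>e. hpoly d (h + e) (\<lambda>X. coeff (Q X j) e) \<and> (e \<ge> N \<longrightarrow> (\<forall>X. coeff (Q X j) e = 0)))"

text \<open>Shared by \<open>step\<close> and \<open>dpoly\<close>, both of the shape q' + (a + b y)
  q.\<close>

lemma hpoly_linear_coeff:
  assumes a: "hpoly d 1 a" and b: "hpoly d 2 b"
    and Q: "\<And>e. hpoly d (h + e) (\<lambda>X. coeff (Q X) e)"
  shows "hpoly d (Suc h + e) (\<lambda>X. real (Suc e) * coeff (Q X) (Suc e) + a X * coeff (Q X) e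
    + (if e = 0 then 0 else b X * coeff (Q X) (e - 1)))"
proof -
  have "hpoly d (Suc h + e) (\<lambda>X. real (Suc e) * coeff (Q X) (Suc e) + a X * coeff (Q X) e)"
    using hpoly_scale[OF Q[of "Suc e"], of "real (Suc e)"] hpoly_mult[OF a Q[of e]]
    by (intro hpoly_add) simp_all
  moreover have "hpoly d (Suc h + e) (\<lambda>X. if e = 0 then 0 else b X * coeff (Q X) (e - 1))"
    using hpoly_mult[OF b Q[of "e - 1"]] by (cases e) (simp_all add: hpoly_zero)
  ultimately show ?thesis by (rule hpoly_add)
qed

lemma hpoly_M: "hpoly d 1 (\<lambda>X. M X j)" unfolding M_def by (rule hpoly_dotp)
lemma hpoly_S: "hpoly d 2 (\<lambda>X. S X j)" unfolding S_def by (rule hpoly_quadf)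

lemma homogeneous_step:
  assumes Q: "homogeneous h N Q"
  shows "homogeneous (Suc h) (Suc N) (\<lambda>X. step (M X) (S X) l (Q X))"
  unfolding homogeneous_def
proof (intro allI impI conjI)
  fix j e assume j: "j < k"
  show "hpoly d (Suc h + e) (\<lambda>X. coeff (step (M X) (S X) l (Q X) j) e)"
    unfolding coeff_step
    by (rule hpoly_linear_coeff) (use Q j in \<open>auto simp: homogeneous_def intro!: hpoly_diff hpoly_M[unfolded One_nat_def] hpoly_S\<close>)
  fix X assume "e \<ge> Suc N"
  then show "coeff (step (M X) (S X) l (Q X) j) e = 0"
    using Q j by (auto simp: coeff_step homogeneous_def)
qed

text \<open>Each \<open>dpoly\<close> raises the weight by one, and the constant coefficient of a
  family of weight n is a form of degree n. Primary terms are therefore forms, and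
  \<open>trep_vnorm\<close> applies to them.\<close>

lemma homogeneous_taylor:
  assumes Q: "homogeneous 0 N Q"
  shows "hpoly d n (\<lambda>X. taylor k (M X) (S X) (Q X) n)"
proof -
  have "hpoly d (n + e) (\<lambda>X. coeff ((dpoly (M X j) (S X j) ^^ n) (Q X j)) e)" if j: "j < k" for j e
  proof (induction n arbitrary: e)
    case 0
    then show ?case using Q j by (auto simp: homogeneous_def)
  next
    case (Suc n)
    have "coeff ((dpoly (M X j) (S X j) ^^ Suc n) (Q X j)) e = real (Suc e) * coeff ((dpoly (M X j) (S X j) ^^ n) (Q X j)) (Suc e)
       + M X j * coeff ((dpoly (M X j) (S X j) ^^ n) (Q X j)) e
       + (if e = 0 then 0 else S X j * coeff ((dpoly (M X j) (S X j) ^^ n) (Q X j)) (e - 1))" for X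
      by (simp only: funpow.simps o_apply dpoly_def[of _ _ "(dpoly _ _ ^^ n) _"] coeff_add coeff_pderiv coeff_linear_mult add.assoc)
    then show ?case
      by (simp only:) (rule hpoly_linear_coeff[OF hpoly_M hpoly_S Suc.IH])
  qed
  from this[where e = 0] show ?thesis
    unfolding taylor_def by (intro hpoly_sum) auto
qed

section \<open>Majorants and measurability for the Fubini steps\<close>

lemma val_expand:
  assumes "homogeneous h N Q"
  shows "val k (M X) (S X) (Q X) t = (\<Sum>j<k. \<Sum>e<N. of_real (coeff (Q X j) e) * (\<i> * of_real t) ^ e * expval (M X j) (S X j) t)"
proof -
  have "cpoly (Q X j) z = (\<Sum>e<N. of_real (coeff (Q X j) e) * z ^ e)" if "j < k" for j z
    by (rule cpoly_altdef) (use assms that in \<open>auto simp: homogeneous_def\<close>)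
  then show ?thesis by (simp add: val_def expval_def sum_distrib_right)
qed

text \<open>One integrable function of X that dominates \<open>val\<close> times \<open>ker\<close>
  for all times and weights at once; its size never enters the final bound.\<close>

definition majorant :: "nat \<Rightarrow> ((nat \<Rightarrow> real) \<Rightarrow> nat \<Rightarrow> real poly) \<Rightarrow> (nat \<Rightarrow> real) \<Rightarrow> real" where
  "majorant N Q X = (\<Sum>j<k. \<Sum>e<N. \<bar>coeff (Q X j) e\<bar> * gw d (1 / \<beta>) X)"

lemma integrable_majorant:
  assumes "homogeneous h N Q"
  shows "integrable (Rd d) (majorant N Q)"
proof -
  have "integrable (Rd d) (\<lambda>X. \<Sum>j<k. \<Sum>e<N. \<bar>coeff (Q X j) e * gw d (1 / \<beta>) X\<bar>)"
    using assms
    by (intro Bochner_Integration.integrable_sum integrable_abs integrable_hpoly_gaussian[OF _ b_pos])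
       (auto simp: homogeneous_def)
  then show ?thesis by (simp add: majorant_def[abs_def] abs_mult gw_def)
qed

lemma cmod_val_ker_le:
  assumes Q: "homogeneous h N Q" and t: "0 \<le> t" "t \<le> 1"
    and w: "\<And>j. j < k \<Longrightarrow> 0 \<le> w j" "(\<Sum>j<k. w j) = 1 - t\<^sup>2"
  shows "cmod (val k (M X) (S X) (Q X) t * ker \<nu> w X) \<le> majorant N Q X"
proof -
  have "cmod (val k (M X) (S X) (Q X) t * ker \<nu> w X)
    = cmod (\<Sum>j<k. \<Sum>e<N. of_real (coeff (Q X j) e) * (\<i> * of_real t) ^ e * (expval (M X j) (S X j) t * ker \<nu> w X))"
    unfolding val_expand[OF Q] by (simp add: sum_distrib_right mult.assoc)
  also have "\<dots> \<le> (\<Sum>j<k. \<Sum>e<N. cmod (of_real (coeff (Q X j) e) * (\<i> * of_real t) ^ e * (expval (M X j) (S X j) t * ker \<nu> w X)))"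
    by (intro order_trans[OF norm_sum] sum_mono norm_sum)
  also have "\<dots> \<le> majorant N Q X"
    unfolding majorant_def
  proof (intro sum_mono)
    fix j e assume j: "j \<in> {..<k}"
    \<comment> \<open>The exponential of index j at time t adds t^2 to the weight of j and restores
      the total 1.\<close>
    have "cmod (ker (\<lambda>i. \<nu> i + (t - 0) * mu j i) (\<lambda>n. w n + (if n = j then t\<^sup>2 - 0\<^sup>2 else 0)) X) \<le> gw d (1 / \<beta>) X"
      using w j by (intro cmod_ker_le) (auto simp: sum.distrib)
    then have "cmod (expval (M X j) (S X j) t * ker \<nu> w X) \<le> gw d (1 / \<beta>) X"
      using j ker_expval[of j X t 0 \<nu> w] by (simp add: expval_def)
    moreover have "cmod (of_real (coeff (Q X j) e) * (\<i> * of_real t) ^ e) \<le> \<bar>coeff (Q X j) e\<bar>"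
      using t by (auto simp: norm_mult norm_power power_le_one intro!: mult_left_le)
    ultimately show "cmod (of_real (coeff (Q X j) e) * (\<i> * of_real t) ^ e * (expval (M X j) (S X j) t * ker \<nu> w X)) \<le> \<bar>coeff (Q X j) e\<bar> * gw d (1 / \<beta>) X"
      unfolding norm_mult[of _ "expval _ _ _ * _"] by (intro mult_mono) auto
  qed
  finally show ?thesis .
qed

lemma measurable_M_S [measurable]:
  "(\<lambda>X. M X j) \<in> borel_measurable (Rd d)" "(\<lambda>X. S X j) \<in> borel_measurable (Rd d)"
  unfolding M_def S_def by measurable

lemma measurable_val_ker:
  assumes Q: "homogeneous h N Q"
  shows "(\<lambda>(t, X). val k (M X) (S X) (Q X) t * ker (\<lambda>i. \<nu> i + (\<tau> - t) * \<mu> i) (\<lambda>j. w j + (if j = l then \<tau>\<^sup>2 - t\<^sup>2 else 0)) X)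
    \<in> borel_measurable (borel \<Otimes>\<^sub>M Rd d)"
proof -
  have m[measurable]: "(\<lambda>X. coeff (Q X j) e) \<in> borel_measurable (Rd d)" if "j \<in> {..<k}" for j e
  proof (rule measurable_hpoly)
    show "hpoly d (h + e) (\<lambda>X. coeff (Q X j) e)" using Q that by (auto simp: homogeneous_def)
  qed
  have dp: "dotp d (\<lambda>i. \<nu> i + (\<tau> - t) * \<mu> i) X = dotp d \<nu> X + (\<tau> - t) * dotp d \<mu> X" for t X
    by (simp add: dotp_def distrib_right sum.distrib sum_distrib_left mult.assoc)
  show ?thesis
    unfolding val_expand[OF Q] ker_def expval_def dp by measurable
qed

lemma measurable_val_ker_fst:
  assumes Q: "homogeneous h N Q"
  shows "(\<lambda>t. val k (M X) (S X) (Q X) t * ker (\<lambda>i. \<nu> i + (\<tau> - t) * \<mu> i) (\<lambda>j. w j + (if j = l then \<tau>\<^sup>2 - t\<^sup>2 else 0)) X)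
    \<in> borel_measurable borel"
proof -
  have dp: "dotp d (\<lambda>i. \<nu> i + (\<tau> - t) * \<mu> i) X = dotp d \<nu> X + (\<tau> - t) * dotp d \<mu> X" for t
    by (simp add: dotp_def distrib_right sum.distrib sum_distrib_left mult.assoc)
  show ?thesis
    unfolding val_expand[OF Q] ker_def expval_def dp by measurable
qed

text \<open>The invariant is that the weights and \<tau>^2 sum to 1. Each operator uses up one
  derivative at 0 and contributes one boundary term; once the chain is exhausted the function is 0.
  K stays fixed while the list shrinks, so that the growth factor is the same at every
  stage.\<close>

lemma L1norm_val_ker:
  assumes "homogeneous h N Q" and "set ls \<subseteq> {..<k}" and "length ls \<le> K"
    and "\<And>X j. j < k \<Longrightarrow> chain (M X) (S X) ls (Q X) j = 0"
    and "\<And>n. n < length ls \<Longrightarrow> trep d (h + n) (\<lambda>X. taylor k (M X) (S X) (Q X) n) B"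
    and "0 \<le> \<tau>" "\<tau> \<le> 1"
    and "\<And>j. j < k \<Longrightarrow> 0 \<le> w j" "(\<Sum>j<k. w j) = 1 - \<tau>\<^sup>2"
  shows "L1norm d (ft d (\<lambda>X. val k (M X) (S X) (Q X) \<tau> * ker \<nu> w X)) \<le>
    ennreal (\<Sum>i<length ls. real (h + i) ^ (h + i) * sqrt \<beta> ^ (h + i) * ((1 + \<alpha> + real K * \<alpha>) ^ i * B))"
  using assms
proof (induction ls arbitrary: h N Q B \<tau> w \<nu>)
  case Nil
  then have "val k (M X) (S X) (Q X) \<tau> = 0" for X by (simp add: val_def)
  then show ?case by (simp add: ft_def L1norm_def)
next
  case (Cons l ls)
  \<comment> \<open>The summands pay for the three terms of \<open>taylor_step\<close>: the next
    derivative, the factor M and n times the factor S, with n \<le> K.\<close>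
  let ?R = "1 + \<alpha> + real K * \<alpha>"
  let ?Q = "\<lambda>X. step (M X) (S X) l (Q X)"
  let ?\<nu> = "\<lambda>t i. \<nu> i + (\<tau> - t) * mu l i"
  let ?w = "\<lambda>t j. w j + (if j = l then \<tau>\<^sup>2 - t\<^sup>2 else 0)"
  \<comment> \<open>Lebesgue measure on the path from 0 to \<tau>; its mass \<tau> is at most 1, so
    integrating over it costs nothing.\<close>
  let ?I = "density lborel (\<lambda>t. ennreal (indicator {0..\<tau>} t))"
  let ?bnd = "\<Sum>i<length ls. real (Suc h + i) ^ (Suc h + i) * sqrt \<beta> ^ (Suc h + i) * (?R ^ i * (?R * B))"
  let ?g = "\<lambda>t X. \<i> * (val k (M X) (S X) (?Q X) t * ker (?\<nu> t) (?w t) X)"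
  have l: "l < k" using Cons.prems(2) by simp
  have R: "1 \<le> ?R" using \<alpha>_nonneg by simp
  have Q': "homogeneous (Suc h) (Suc N) ?Q" by (rule homogeneous_step[OF Cons.prems(1)])
  have B: "0 \<le> B" using trep_nonneg[OF Cons.prems(5)[of 0]] by simp
  have bnd: "0 \<le> ?bnd" using R B \<beta>_pos by (intro sum_nonneg mult_nonneg_nonneg zero_le_power) auto
  have w': "0 \<le> ?w t j" "(\<Sum>j<k. ?w t j) = 1 - t\<^sup>2" if t: "0 \<le> t" "t \<le> \<tau>" and j: "j < k" for t j
    using Cons.prems(8)[OF j] Cons.prems(9) l t power_mono[OF t(2,1), of 2] by (auto simp: sum.distrib)
  have tay: "trep d (Suc h + n) (\<lambda>X. taylor k (M X) (S X) (?Q X) n) (?R * B)" if n: "n < length ls" for n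
  proof -
    have t1: "trep d (Suc h + n) (\<lambda>X. taylor k (M X) (S X) (Q X) (Suc n)) B"
      using Cons.prems(5)[of "Suc n"] n by simp
    have t2: "trep d (Suc h + n) (\<lambda>X. M X l * taylor k (M X) (S X) (Q X) n) (\<alpha> * B)"
      using trep_mult[OF trep_M[OF l] Cons.prems(5)[of n]] n by simp
    \<comment> \<open>S has degree 2 and comes with the derivative of order n - 1, so the degree is
      again h + n + 1; for n = 0 the term is 0.\<close>
    have t3: "trep d (Suc h + n) (\<lambda>X. real n * S X l * taylor k (M X) (S X) (Q X) (n - 1)) (real n * \<alpha> * B)"
    proof (cases n)
      case 0
      then show ?thesis using trep_zero by simp
    next
      case (Suc n')
      have "trep d (2 + (h + n')) (\<lambda>X. real n * (S X l * taylor k (M X) (S X) (Q X) n')) (\<bar>real n\<bar> * (\<alpha> * B))"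
        by (intro trep_scale trep_mult trep_S[OF l] Cons.prems(5)) (use n Suc in simp)
      then show ?thesis by (simp add: Suc mult.assoc)
    qed
    have "real n * (\<alpha> * B) \<le> real K * (\<alpha> * B)"
      using n Cons.prems(3) B \<alpha>_nonneg by (intro mult_right_mono) auto
    then have "B + \<alpha> * B + real n * \<alpha> * B \<le> ?R * B" by (simp add: algebra_simps)
    then show ?thesis
      unfolding taylor_step by (rule trep_mono[OF trep_diff[OF trep_diff[OF t1 t2] t3]])
  qed
  have IH: "L1norm d (ft d (?g t)) \<le> ennreal ?bnd" if t: "0 \<le> t" "t \<le> \<tau>" for t
    unfolding L1norm_ft_mult_i
  proof (rule Cons.IH[OF Q'])
    show "chain (M X) (S X) ls (?Q X) j = 0" if "j < k" for X j
      using Cons.prems(4)[OF that, of X] by simp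
  qed (use Cons.prems(2,3,7) t k w'[OF t] tay in auto)
  have emI: "emeasure ?I (space ?I) = ennreal \<tau>"
    using Cons.prems(6) by (simp add: emeasure_density ennreal_indicator)
  have int: "integrable (?I \<Otimes>\<^sub>M Rd d) (\<lambda>(t, X). ?g t X)"
  proof (rule integrable_pair_dominated[OF _ integrable_majorant[OF Q']])
    show "finite_measure ?I"
      by (rule finite_measureI) (simp only: emI, simp)
    have "AE t in lborel. indicator {0..\<tau>} t > (0::real) \<longrightarrow> (\<forall>X. cmod (?g t X) \<le> majorant (Suc N) ?Q X)"
    proof (rule AE_I2, intro impI allI)
      fix t X assume "indicator {0..\<tau>} t > (0::real)"
      then have t: "0 \<le> t" "t \<le> \<tau>" by (auto simp: indicator_def split: if_splits)
      show "cmod (?g t X) \<le> majorant (Suc N) ?Q X"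
        using cmod_val_ker_le[OF Q', of t "?w t" X "?\<nu> t"] t k w'[OF t] Cons.prems(7)
        by (simp add: norm_mult)
    qed
    then show "AE t in ?I. \<forall>X. cmod (?g t X) \<le> majorant (Suc N) ?Q X"
      by (simp add: AE_density)
    show "(\<lambda>(t, X). ?g t X) \<in> borel_measurable (?I \<Otimes>\<^sub>M Rd d)"
      using borel_measurable_times[OF borel_measurable_const[of \<i>] measurable_val_ker[OF Q', of \<nu> \<tau> "mu l" w l]]
      by (simp add: case_prod_beta' cong: measurable_cong_sets sets_pair_measure_cong)
  qed
  \<comment> \<open>Variation of constants multiplied by the kernel. The boundary term sits at t =
    0, where the weights total 1 and \<open>L1norm_hpoly_ker\<close> applies; under the integral
    stands the situation of the induction hypothesis.\<close>
  have split: "val k (M X) (S X) (Q X) \<tau> * ker \<nu> w X =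
      complex_of_real (taylor k (M X) (S X) (Q X) 0) * ker (?\<nu> 0) (?w 0) X + (\<integral>t. ?g t X \<partial>?I)" for X
  proof -
    have "(\<integral>t. ?g t X \<partial>?I) = (\<integral>t. indicator {0..\<tau>} t *\<^sub>R ?g t X \<partial>lborel)"
    proof (rule integral_density)
      show "(\<lambda>t. ?g t X) \<in> borel_measurable lborel"
        using borel_measurable_times[OF borel_measurable_const[of \<i>] measurable_val_ker_fst[OF Q', of X \<nu> \<tau> "mu l" w l]] by simp
    qed auto
    also have "\<dots> = (\<integral>t. (expval (M X l) (S X l) \<tau> * ker \<nu> w X) * (indicator {0..\<tau>} t *\<^sub>R (\<i> * (val k (M X) (S X) (?Q X) t * expval (- M X l) (- S X l) t))) \<partial>lborel)"
      unfolding ker_expval[OF l, symmetric] by (intro Bochner_Integration.integral_cong) (simp_all add: scaleR_conv_of_real mult_ac)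
    also have "\<dots> = (expval (M X l) (S X l) \<tau> * ker \<nu> w X) * (\<integral>t. indicator {0..\<tau>} t *\<^sub>R (\<i> * (val k (M X) (S X) (?Q X) t * expval (- M X l) (- S X l) t)) \<partial>lborel)"
      by (rule integral_mult_right_zero)
    moreover have "ker (?\<nu> 0) (?w 0) X = expval (M X l) (S X l) \<tau> * ker \<nu> w X"
      unfolding ker_expval[OF l, symmetric] by (simp add: expval_def)
    ultimately show ?thesis
      unfolding val_variation_of_constants[OF Cons.prems(6), of k "M X" "S X" "Q X" l]
      by (simp only: distrib_left distrib_right mult_ac)
  qed
  have t0: "trep d h (\<lambda>X. taylor k (M X) (S X) (Q X) 0) B" using Cons.prems(5)[of 0] by simp
  have w0: "\<And>j. j < k \<Longrightarrow> 0 \<le> ?w 0 j" "(\<Sum>j<k. ?w 0 j) = 1"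
    using w'[of 0] Cons.prems(6) k by auto
  have int0: "integrable (Rd d) (\<lambda>X. complex_of_real (taylor k (M X) (S X) (Q X) 0) * ker (?\<nu> 0) (?w 0) X)"
  proof (rule Bochner_Integration.integrable_bound)
    have h0: "hpoly d h (\<lambda>X. taylor k (M X) (S X) (Q X) 0)" using t0 unfolding hpoly_def by blast
    show "integrable (Rd d) (\<lambda>X. taylor k (M X) (S X) (Q X) 0 * gw d (1 / \<beta>) X)"
      by (rule integrable_hpoly_gaussian[OF h0 b_pos])
    note [measurable] = measurable_hpoly[OF h0]
    show "(\<lambda>X. complex_of_real (taylor k (M X) (S X) (Q X) 0) * ker (?\<nu> 0) (?w 0) X) \<in> borel_measurable (Rd d)"
      unfolding ker_def by measurable
    show "AE X in Rd d. norm (complex_of_real (taylor k (M X) (S X) (Q X) 0) * ker (?\<nu> 0) (?w 0) X) \<le> norm (taylor k (M X) (S X) (Q X) 0 * gw d (1 / \<beta>) X)"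
      using cmod_ker_le[OF w0] by (intro AE_I2) (simp add: norm_mult abs_mult mult_left_mono gw_def)
  qed
  interpret I: finite_measure ?I
    by (rule finite_measureI) (simp only: emI, simp)
  interpret Rs: sigma_finite_measure "Rd d" by (rule sigma_finite_Rd)
  interpret P: pair_sigma_finite ?I "Rd d" by standard
  have "L1norm d (ft d (\<lambda>X. val k (M X) (S X) (Q X) \<tau> * ker \<nu> w X))
    \<le> L1norm d (ft d (\<lambda>X. complex_of_real (taylor k (M X) (S X) (Q X) 0) * ker (?\<nu> 0) (?w 0) X)) + L1norm d (ft d (\<lambda>X. \<integral>t. ?g t X \<partial>?I))"
    unfolding split by (rule L1norm_ft_add[OF int0 P.integrable_snd[OF int]])
  also have "\<dots> \<le> ennreal (real h ^ h * sqrt \<beta> ^ h * B) + ennreal ?bnd"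
  proof (rule add_mono)
    show "L1norm d (ft d (\<lambda>X. complex_of_real (taylor k (M X) (S X) (Q X) 0) * ker (?\<nu> 0) (?w 0) X)) \<le> ennreal (real h ^ h * sqrt \<beta> ^ h * B)"
      by (rule L1norm_hpoly_ker[OF t0 w0])
    have "L1norm d (ft d (\<lambda>X. \<integral>t. ?g t X \<partial>?I)) \<le> (\<integral>\<^sup>+t. L1norm d (ft d (?g t)) \<partial>?I)"
      by (rule ft_mixture[OF I.sigma_finite_measure_axioms int])
    also have "\<dots> \<le> (\<integral>\<^sup>+t. ennreal ?bnd \<partial>?I)"
    proof (rule nn_integral_mono_AE)
      show "AE t in ?I. L1norm d (ft d (?g t)) \<le> ennreal ?bnd"
        using IH by (auto simp: AE_density indicator_def)
    qed
    also have "\<dots> = ennreal ?bnd * ennreal \<tau>"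
      by (simp only: nn_integral_const emI)
    also have "\<dots> \<le> ennreal ?bnd"
      using Cons.prems(6,7) bnd by (simp add: mult_left_le flip: ennreal_mult)
    finally show "L1norm d (ft d (\<lambda>X. \<integral>t. ?g t X \<partial>?I)) \<le> ennreal ?bnd" .
  qed
  also have "\<dots> = ennreal (real h ^ h * sqrt \<beta> ^ h * B + ?bnd)"
    using B bnd \<beta>_pos by (intro ennreal_plus[symmetric]) auto
  also have "real h ^ h * sqrt \<beta> ^ h * B + ?bnd =
     (\<Sum>i<length (l # ls). real (h + i) ^ (h + i) * sqrt \<beta> ^ (h + i) * (?R ^ i * B))"
    unfolding list.size(4) add_0_right add_Suc_right sum.lessThan_Suc_shift
    by (simp add: mult_ac)
  finally show ?case .
qed

end

section \<open>The initial family and the final constant\<close>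

definition line_poly :: "nat \<Rightarrow> nat \<Rightarrow> ((nat \<Rightarrow> nat) \<Rightarrow> real) \<Rightarrow> (nat \<Rightarrow> real) \<Rightarrow> real poly" where
  "line_poly d m c X = (\<Sum>a\<in>multi_idx d m. monom (c a * (\<Prod>i<d. X i ^ a i)) (\<Sum>i<d. a i))"

lemma poly_line_poly: "poly (line_poly d m c X) y = mpoly_eval d m c (\<lambda>i. X i * y)"
  by (simp add: line_poly_def mpoly_eval_def poly_sum poly_monom power_mult_distrib prod.distrib power_sum mult.assoc)

lemma cpoly_line_poly: "cpoly (line_poly d m c X) \<i> = mpoly_eval d m c (\<lambda>i. \<i> * complex_of_real (X i))"
  by (simp add: line_poly_def mpoly_eval_def cpoly_sum cpoly_monom power_mult_distrib prod.distrib power_sum mult_ac)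

lemma coeff_line_poly_eq_0: "Suc m \<le> e \<Longrightarrow> coeff (line_poly d m c X) e = 0"
  unfolding line_poly_def coeff_sum by (rule sum.neutral) (auto simp: multi_idx_def)

text \<open>The coefficient of y^e on the line through X is the homogeneous part of degree e of the
  polynomial.\<close>

lemma hpoly_coeff_line_poly: "hpoly d e (\<lambda>X. coeff (line_poly d m c X) e)"
proof -
  have "hpoly d e (\<lambda>X. coeff (monom (c a * (\<Prod>i<d. X i ^ a i)) (\<Sum>i<d. a i)) e)" for a
    using hpoly_scale[OF hpoly_monomial[of d a], of "c a"]
    by (cases "(\<Sum>i<d. a i) = e") (simp_all add: hpoly_zero)
  then show ?thesis unfolding line_poly_def coeff_sum by (rule hpoly_sum)
qed

text \<open>The base is at least 2, so purely numerical factors such as N \<le> 2^N also become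
  powers of it. The four summands of the exponent pay, in order, for the number of terms, for i^i,
  for the power of sqrt \<beta> and for the power of the growth factor.\<close>

lemma constant_absorption:
  fixes \<alpha> \<beta> \<epsilon> :: real
  assumes "0 \<le> \<alpha>" "0 < \<beta>" "0 \<le> \<epsilon>"
  shows "(\<Sum>i<N. real i ^ i * sqrt \<beta> ^ i * ((1 + \<alpha> + real N * \<alpha>) ^ i * \<epsilon>)) \<le> (2 + \<alpha> + \<beta>) ^ (N + N * N + N + N * Suc N) * \<epsilon>"
proof -
  let ?s = "2 + \<alpha> + \<beta>"
  have s: "2 \<le> ?s" "1 \<le> ?s" using assms by auto
  have pow2: "2 ^ n \<le> ?s ^ n" for n using s by (intro power_mono) auto
  have lt: "real n \<le> 2 ^ n" for n
    using less_exp[of n] by (metis less_imp_le of_nat_le_iff of_nat_numeral of_nat_power)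
  have N: "real N \<le> ?s ^ N" using lt pow2 order_trans by blast
  have term_le: "real i ^ i * sqrt \<beta> ^ i * ((1 + \<alpha> + real N * \<alpha>) ^ i * \<epsilon>) \<le> ?s ^ (N * N) * ?s ^ N * (?s ^ (N * Suc N) * \<epsilon>)"
    if i: "i < N" for i
  proof -
    have "real i ^ i \<le> (?s ^ N) ^ i"
      using i N by (intro power_mono) auto
    also have "\<dots> \<le> ?s ^ (N * N)"
      unfolding power_mult[symmetric] using i s by (intro power_increasing) auto
    finally have 1: "real i ^ i \<le> ?s ^ (N * N)" .
    have "sqrt \<beta> \<le> ?s"
    proof (rule real_le_lsqrt)
      have "\<beta> \<le> ?s * 1" using assms by simp
      also have "\<dots> \<le> ?s * ?s" using s by (intro mult_left_mono) auto
      finally show "\<beta> \<le> ?s\<^sup>2" by (simp add: power2_eq_square)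
    qed (use s in auto)
    then have "sqrt \<beta> ^ i \<le> ?s ^ i" using assms by (intro power_mono) auto
    also have "\<dots> \<le> ?s ^ N" using i s by (intro power_increasing) auto
    finally have 2: "sqrt \<beta> ^ i \<le> ?s ^ N" .
    have "1 + real N \<le> 2 ^ N"
      using less_exp[of N] by (metis Suc_leI of_nat_Suc of_nat_le_iff of_nat_numeral of_nat_power)
    then have "1 + real N \<le> ?s ^ N" using pow2 order_trans by blast
    then have "(1 + \<alpha>) * (1 + real N) \<le> ?s * ?s ^ N" using assms by (intro mult_mono) auto
    moreover have "1 + \<alpha> + real N * \<alpha> \<le> (1 + \<alpha>) * (1 + real N)" using assms by (simp add: algebra_simps)
    ultimately have "1 + \<alpha> + real N * \<alpha> \<le> ?s ^ Suc N" by simp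
    then have "(1 + \<alpha> + real N * \<alpha>) ^ i \<le> (?s ^ Suc N) ^ i" using assms by (intro power_mono) auto
    also have "\<dots> \<le> ?s ^ (N * Suc N)"
      unfolding power_mult[symmetric] mult.commute[of N] using i s by (intro power_increasing mult_le_mono) auto
    finally have 3: "(1 + \<alpha> + real N * \<alpha>) ^ i \<le> ?s ^ (N * Suc N)" .
    show ?thesis
      using assms by (intro mult_mono 1 2 3) auto
  qed
  have "(\<Sum>i<N. real i ^ i * sqrt \<beta> ^ i * ((1 + \<alpha> + real N * \<alpha>) ^ i * \<epsilon>)) \<le> real N * (?s ^ (N * N) * ?s ^ N * (?s ^ (N * Suc N) * \<epsilon>))"
    using sum_mono[of "{..<N}", OF term_le] by simp
  also have "\<dots> \<le> ?s ^ N * (?s ^ (N * N) * ?s ^ N * (?s ^ (N * Suc N) * \<epsilon>))"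
    using assms by (intro mult_right_mono N) auto
  also have "\<dots> = ?s ^ (N + N * N + N + N * Suc N) * \<epsilon>"
    by (simp only: power_add mult.assoc)
  finally show ?thesis .
qed

theorem theorem5p12:
  fixes k m :: nat
  assumes "0 < k" and "0 < m"
  shows "\<exists>C::nat. \<forall>(d::nat) (\<alpha>::real) (\<beta>::real) (\<epsilon>::real) mu Sig c.
     1 \<le> d \<longrightarrow> regular_form d k \<alpha> \<beta> mu Sig \<longrightarrow>
     (\<forall>r\<le>C. vnorm d r (primary_term d m k c mu Sig r) \<le> \<epsilon>) \<longrightarrow>
     L1norm d (chi d (gen_fun_i d m k c mu Sig)) \<le> ennreal ((2 + \<alpha> + \<beta>) ^ C * \<epsilon>)"
proof -
  obtain ls where ls: "set ls \<subseteq> {..<k}"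
    "\<And>m' s Q. (\<forall>j<k. \<forall>e\<ge>Suc m. coeff (Q j) e = 0) \<Longrightarrow> (\<forall>j<k. chain m' s ls Q j = 0)"
    using annihilating_chain_exists[of k "Suc m"] by blast
  define N where "N = length ls"
  \<comment> \<open>C is both the exponent and the range of controlled primary terms; the chain asks
    for those of index below N, and N \<le> C.\<close>
  define C where "C = N + N * N + N + N * Suc N"
  show ?thesis
  proof (intro exI[of _ C] allI impI)
    fix d :: nat and \<alpha> \<beta> \<epsilon> :: real and mu Sig c
    assume reg: "regular_form d k \<alpha> \<beta> mu Sig"
      and small: "\<forall>r\<le>C. vnorm d r (primary_term d m k c mu Sig r) \<le> \<epsilon>"
    interpret gaussian_family d k \<alpha> \<beta> mu Sig by standard (use assms reg in auto)
    let ?Q = "\<lambda>X j. line_poly d m (c j) X"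
    have Q: "homogeneous 0 (Suc m) ?Q"
      unfolding homogeneous_def using hpoly_coeff_line_poly coeff_line_poly_eq_0 by simp
    have prim: "primary_term d m k c mu Sig r = (\<lambda>X. taylor k (M X) (S X) (?Q X) r)" for r
    proof
      fix X
      have "gen_fun d m k c mu Sig X = (\<lambda>y. \<Sum>j<k. poly (?Q X j) y * exp (M X j * y + 1/2 * S X j * y\<^sup>2))"
        by (simp add: gen_fun_def fun_eq_iff poly_line_poly M_def S_def)
      then show "primary_term d m k c mu Sig r X = taylor k (M X) (S X) (?Q X) r"
        by (simp only: primary_term_def deriv_funpow_exp_poly) (simp add: taylor_def poly_0_coeff_0)
    qed
    \<comment> \<open>Some tensor exists by homogeneity, and then the one measured by
      \<open>vnorm\<close> represents the primary term as well.\<close>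
    have tay: "trep d r (\<lambda>X. taylor k (M X) (S X) (?Q X) r) \<epsilon>" if "r \<le> C" for r
    proof -
      obtain B where "trep d r (\<lambda>X. taylor k (M X) (S X) (?Q X) r) B"
        using homogeneous_taylor[OF Q, of r] unfolding hpoly_def by blast
      then show ?thesis using trep_vnorm trep_mono small that unfolding prim by blast
    qed
    have \<epsilon>: "0 \<le> \<epsilon>" using trep_nonneg[OF tay[of 0]] by simp
    \<comment> \<open>The descent starts at \<tau> = 1 with zero weights: their sum is 1 - 1^2, and
      the kernel is the bare weight of \<open>chi\<close>.\<close>
    have chi_eq: "chi d (gen_fun_i d m k c mu Sig) = ft d (\<lambda>X. val k (M X) (S X) (?Q X) 1 * ker (\<lambda>_. 0) (\<lambda>_. 0) X)"
    proof
      fix t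
      have "gen_fun_i d m k c mu Sig X = val k (M X) (S X) (?Q X) 1" for X
        by (simp add: gen_fun_i_def val_def cpoly_line_poly M_def S_def)
      then show "chi d (gen_fun_i d m k c mu Sig) t = ft d (\<lambda>X. val k (M X) (S X) (?Q X) 1 * ker (\<lambda>_. 0) (\<lambda>_. 0) X) t"
        by (simp add: chi_def ft_def ker_def dotp_def[of d "\<lambda>_. 0"] mult.assoc flip: exp_add)
    qed
    have "L1norm d (chi d (gen_fun_i d m k c mu Sig)) \<le> ennreal (\<Sum>i<length ls. real (0 + i) ^ (0 + i) * sqrt \<beta> ^ (0 + i) * ((1 + \<alpha> + real N * \<alpha>) ^ i * \<epsilon>))"
      unfolding chi_eq
    proof (rule L1norm_val_ker[OF Q ls(1)])
      show "chain (M X) (S X) ls (?Q X) j = 0" if "j < k" for X j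
        using ls(2)[of "?Q X" "M X" "S X"] coeff_line_poly_eq_0 that by blast
      show "trep d (0 + n) (\<lambda>X. taylor k (M X) (S X) (?Q X) n) \<epsilon>" if "n < length ls" for n
        using tay[of n] that by (simp add: C_def N_def)
    qed (simp_all add: N_def)
    then show "L1norm d (chi d (gen_fun_i d m k c mu Sig)) \<le> ennreal ((2 + \<alpha> + \<beta>) ^ C * \<epsilon>)"
      using constant_absorption[OF \<alpha>_nonneg \<beta>_pos \<epsilon>, of N] unfolding C_def N_def
      by (elim order_trans) (intro ennreal_leI, simp)
  qed
qed

end
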